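(* Let $S_1\colon H_1\to\mathcal{G}_1$ be a compact linear operator between real Hilbert spaces, let $\lambda=(\lambda_m)_{m\in\mathbb{N}}$ be the non-increasing sequence of eigenvalues of $S_1^\dagger S_1$ (extended by zeros), and assume $\lambda_2>0$. Let $(s_d)_{d\in\mathbb{N}}$ be an arbitrary sequence of positive reals and let $S_{(s)}=(S_{d,s_d}\colon\mathcal{F}_d\to\mathcal{G}_d)_{d\in\mathbb{N}}$ be the associated scaled tensor product problem, studied in the worst case setting with respect to the absolute error criterion. Then the following assertions are equivalent: (I) $S_{(s)}$ is strongly polynomially tractable. (II) $S_{(s)}$ is polynomially tractable. (III) There exists $\tau\in(0,\infty)$ such that $\lambda\in\ell_\tau$ and $\sup_{d\in\mathbb{N}} s_d\,\|\lambda\mid\ell_\tau\|^d<\infty$. (IV) There exists $\rho\in(0,\infty)$ such that $\lambda\in\ell_\rho$ and $\limsup_{d\to\infty}s_d^{1/d}<\frac{1}{\lambda_1}$. If one of these (and hence all) conditions applies then the exponent of strong polynomial tractability is $p^*=\inf\{2\tau \mid \tau \text{ fulfills condition (III)}\}$.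
   Context: Tensor product problem: for $d\in\mathbb{N}$ let $H_d=H_1\otimes\cdots\otimes H_1$ and $\mathcal{G}_d=\mathcal{G}_1\otimes\cdots\otimes\mathcal{G}_1$ be the $d$-fold Hilbert space tensor products and $S_d=S_1\otimes\cdots\otimes S_1\colon H_d\to\mathcal{G}_d$. Scaled problem: $\mathcal{F}_d$ is the vector space $H_d$ equipped with the inner product $\langle\cdot,\cdot\rangle_{\mathcal{F}_d}=\frac1{s_d}\langle\cdot,\cdot\rangle_{H_d}$, and $S_{d,s_d}\colon\mathcal{F}_d\to\mathcal{G}_d$ is $S_d$ regarded as an operator on $\mathcal{F}_d$. Eigenvalues of $S_1^\dagger S_1$ are counted with multiplicity and listed non-increasingly; if there are only finitely many positive ones, the sequence is extended by zeros. $\|\lambda\mid\ell_\tau\|=(\sum_m\lambda_m^\tau)^{1/\tau}$ for $\tau\in(0,\infty)$. Worst case setting: the $n$th minimal error is $e(n,d)=\inf_A\sup_{\|f\mid\mathcal{F}_d\|\le1}\|S_{d,s_d}f-Af\mid\mathcal{G}_d\|$, the infimum being over linear algorithms $Af=\sum_{j=1}^nL_j(f)g_j$ with continuous linear functionals $L_j$ on $\mathcal{F}_d$ and $g_j\in\mathcal{G}_d$ ($A=0$ if $n=0$). The information complexity for the absolute error criterion is $n(\varepsilon,d)=\min\{n\in\mathbb{N}_0\mid e(n,d)\le\varepsilon\}$. The problem is polynomially tractable if there are $C,p>0$ and $q\ge0$ with $n(\varepsilon,d)\le C\varepsilon^{-p}d^q$ for all $\varepsilon\in(0,1]$, $d\in\mathbb{N}$;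 it is strongly polynomially tractable if this holds with $q=0$. The exponent of strong polynomial tractability $p^*$ is the infimum of all $p>0$ for which there is $C>0$ with $n(\varepsilon,d)\le C\varepsilon^{-p}$ for all $\varepsilon\in(0,1]$, $d\in\mathbb{N}$. *)

theory Defs
  imports "HOL-Analysis.Analysis"
begin

definition compact_operator :: "('a::real_normed_vector \<Rightarrow> 'b::real_normed_vector) \<Rightarrow> bool" where
  "compact_operator S \<longleftrightarrow> linear S \<and> compact (closure (S ` cball 0 1))"

text \<open>
  Sequences indexed by the positive integers are shifted to start at \<open>0\<close>, so the largest
  eigenvalue is \<open>lam 0\<close>. A non-increasing nonnegative sequence is determined by the number of
  occurrences of each positive value; if there are only finitely many positive entries, all later
  ones are forced to be \<open>0\<close>. Positive eigenvalues of a compact operator have finite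
  multiplicity, so the convention that \<open>dim\<close> is \<open>0\<close> for infinite-dimensional spaces
  plays no role.
\<close>
definition eigenvalue_sequence :: "('a::real_vector \<Rightarrow> 'a) \<Rightarrow> (nat \<Rightarrow> real) \<Rightarrow> bool" where
  "eigenvalue_sequence T lam \<longleftrightarrow>
     decseq lam \<and> (\<forall>m. 0 \<le> lam m) \<and>
     (\<forall>\<mu>>0. finite {m. lam m = \<mu>} \<and> card {m. lam m = \<mu>} = dim {x. T x = \<mu> *\<^sub>R x})"

definition in_ell :: "real \<Rightarrow> (nat \<Rightarrow> real) \<Rightarrow> bool" where
  "in_ell \<tau> lam \<longleftrightarrow> summable (\<lambda>m. lam m powr \<tau>)"

definition ell_norm :: "real \<Rightarrow> (nat \<Rightarrow> real) \<Rightarrow> real" where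
  "ell_norm \<tau> lam = (\<Sum>m. lam m powr \<tau>) powr (1 / \<tau>)"

text \<open>
  The \<open>d\<close>-fold Hilbert space tensor power of a Hilbert space, given as a closed subspace
  \<open>V\<close> of an arbitrary Hilbert space together with the map
  \<open>T x = x 0 \<otimes> \<dots> \<otimes> x (d - 1)\<close>. It is characterised up to isometric isomorphism by the
  inner products of elementary tensors and the density of their span; multilinearity
  follows (see below). The arguments \<open>x i\<close> with \<open>i \<ge> d\<close> are irrelevant. Spaces for
  different \<open>d\<close> may share an ambient space, which is no restriction because any sequence of
  Hilbert spaces embeds isometrically in its Hilbert sum.
\<close>
definition hilbert_tensor_power ::
    "nat \<Rightarrow> ((nat \<Rightarrow> 'a::real_inner) \<Rightarrow> 'h::real_inner) \<Rightarrow> 'h set \<Rightarrow> bool" where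
  "hilbert_tensor_power d T V \<longleftrightarrow>
     (\<forall>x y. T x \<bullet> T y = (\<Prod>i<d. x i \<bullet> y i)) \<and> V = closure (span (range T))"

lemma hilbert_tensor_power_inner_upd:
  assumes "hilbert_tensor_power d T V" and "i < d"
  shows "T (x(i := a)) \<bullet> T (x(i := b)) = (a \<bullet> b) * (\<Prod>j\<in>{..<d} - {i}. x j \<bullet> x j)"
proof -
  have "T (x(i := a)) \<bullet> T (x(i := b)) = (\<Prod>j<d. (x(i := a)) j \<bullet> (x(i := b)) j)"
    using assms(1) unfolding hilbert_tensor_power_def by blast
  also have "\<dots> = (a \<bullet> b) * (\<Prod>j\<in>{..<d} - {i}. (x(i := a)) j \<bullet> (x(i := b)) j)"
    using assms(2) by (subst prod.remove[of _ i]) auto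
  also have "(\<Prod>j\<in>{..<d} - {i}. (x(i := a)) j \<bullet> (x(i := b)) j) = (\<Prod>j\<in>{..<d} - {i}. x j \<bullet> x j)"
    by (intro prod.cong) auto
  finally show ?thesis .
qed

lemma hilbert_tensor_power_linear_upd:
  assumes "hilbert_tensor_power d T V" and "i < d"
  shows "linear (\<lambda>a. T (x(i := a)))"
proof (rule linearI)
  note upd = hilbert_tensor_power_inner_upd[OF assms]
  fix a b :: 'a and c :: real
  let ?P = "\<lambda>a. T (x(i := a))"
  let ?u = "?P (a + b) - (?P a + ?P b)" and ?v = "?P (c *\<^sub>R a) - c *\<^sub>R ?P a"
  have "?u \<bullet> ?u = 0"
    by (simp only: inner_diff_left inner_diff_right inner_add_left inner_add_right upd)
       (simp add: algebra_simps)
  then show "?P (a + b) = ?P a + ?P b" by simp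
  have "?v \<bullet> ?v = 0"
    by (simp only: inner_diff_left inner_diff_right inner_scaleR_left inner_scaleR_right upd)
       (simp add: algebra_simps)
  then show "?P (c *\<^sub>R a) = c *\<^sub>R ?P a" by simp
qed

text \<open>
  Continuity of a linear map on the subspace \<open>V\<close>, equipped with the norm \<open>N\<close>; only
  the values on \<open>V\<close> matter.
\<close>
definition continuous_linear_on ::
    "'v::real_vector set \<Rightarrow> ('v \<Rightarrow> real) \<Rightarrow> ('v \<Rightarrow> 'w::real_normed_vector) \<Rightarrow> bool" where
  "continuous_linear_on V N f \<longleftrightarrow>
     (\<forall>x\<in>V. \<forall>y\<in>V. f (x + y) = f x + f y) \<and>
     (\<forall>c. \<forall>x\<in>V. f (c *\<^sub>R x) = c *\<^sub>R f x) \<and>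
     (\<exists>K. \<forall>x\<in>V. norm (f x) \<le> K * N x)"

text \<open>
  \<open>S \<otimes> \<dots> \<otimes> S\<close> is the continuous linear extension of its action on elementary tensors,
  unique on \<open>V\<close> by density.
\<close>
definition tensor_power_operator ::
    "('a \<Rightarrow> 'b) \<Rightarrow> ((nat \<Rightarrow> 'a) \<Rightarrow> 'h::real_normed_vector) \<Rightarrow> 'h set \<Rightarrow>
     ((nat \<Rightarrow> 'b) \<Rightarrow> 'g::real_normed_vector) \<Rightarrow> 'g set \<Rightarrow> ('h \<Rightarrow> 'g) \<Rightarrow> bool" where
  "tensor_power_operator S T V T' W R \<longleftrightarrow>
     continuous_linear_on V norm R \<and> R ` V \<subseteq> W \<and> (\<forall>x. R (T x) = T' (\<lambda>i. S (x i)))"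

definition scaled_inner :: "real \<Rightarrow> 'h::real_inner \<Rightarrow> 'h \<Rightarrow> real" where
  "scaled_inner s x y = (1 / s) * (x \<bullet> y)"

definition scaled_norm :: "real \<Rightarrow> 'h::real_inner \<Rightarrow> real" where
  "scaled_norm s x = sqrt (scaled_inner s x x)"

definition linear_algorithms ::
    "'h::real_vector set \<Rightarrow> ('h \<Rightarrow> real) \<Rightarrow> 'g::real_vector set \<Rightarrow> nat \<Rightarrow> ('h \<Rightarrow> 'g) set" where
  "linear_algorithms V N W n =
     {A. \<exists>(L :: nat \<Rightarrow> 'h \<Rightarrow> real) g. (\<forall>j<n. continuous_linear_on V N (L j) \<and> g j \<in> W) \<and>
           A = (\<lambda>f. \<Sum>j<n. L j f *\<^sub>R g j)}"

text \<open>
  For a continuous linear \<open>R\<close> on \<open>V\<close>, every set below is nonempty and bounded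
  in the relevant direction, so the real-valued supremum and infimum are the genuine ones.
\<close>
definition worst_case_error ::
    "'h set \<Rightarrow> ('h \<Rightarrow> real) \<Rightarrow> ('h \<Rightarrow> 'g::real_normed_vector) \<Rightarrow> ('h \<Rightarrow> 'g) \<Rightarrow> real" where
  "worst_case_error V N R A = (SUP f\<in>{f\<in>V. N f \<le> 1}. norm (R f - A f))"

definition minimal_error ::
    "'h::real_vector set \<Rightarrow> ('h \<Rightarrow> real) \<Rightarrow> 'g::real_normed_vector set \<Rightarrow> ('h \<Rightarrow> 'g) \<Rightarrow> nat \<Rightarrow> real" where
  "minimal_error V N W R n = (INF A\<in>linear_algorithms V N W n. worst_case_error V N R A)"

text \<open>
  The minimum exists for every \<open>\<epsilon> > 0\<close> when \<open>R\<close> is compact, as is the case for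
  tensor powers of compact operators.
\<close>
definition information_complexity ::
    "'h::real_vector set \<Rightarrow> ('h \<Rightarrow> real) \<Rightarrow> 'g::real_normed_vector set \<Rightarrow> ('h \<Rightarrow> 'g) \<Rightarrow> real \<Rightarrow> nat" where
  "information_complexity V N W R \<epsilon> = (LEAST n. minimal_error V N W R n \<le> \<epsilon>)"

definition complexity_bound :: "(real \<Rightarrow> nat \<Rightarrow> nat) \<Rightarrow> real \<Rightarrow> real \<Rightarrow> real \<Rightarrow> bool" where
  "complexity_bound n C p q \<longleftrightarrow>
     (\<forall>\<epsilon>\<in>{0<..1}. \<forall>d\<ge>1. real (n \<epsilon> d) \<le> C * \<epsilon> powr (-p) * real d powr q)"

definition polynomially_tractable :: "(real \<Rightarrow> nat \<Rightarrow> nat) \<Rightarrow> bool" where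
  "polynomially_tractable n \<longleftrightarrow> (\<exists>C>0. \<exists>p>0. \<exists>q\<ge>0. complexity_bound n C p q)"

definition strongly_polynomially_tractable :: "(real \<Rightarrow> nat \<Rightarrow> nat) \<Rightarrow> bool" where
  "strongly_polynomially_tractable n \<longleftrightarrow> (\<exists>C>0. \<exists>p>0. complexity_bound n C p 0)"

definition strong_tractability_exponent :: "(real \<Rightarrow> nat \<Rightarrow> nat) \<Rightarrow> real" where
  "strong_tractability_exponent n = Inf {p. 0 < p \<and> (\<exists>C>0. complexity_bound n C p 0)}"

definition scaled_complexity ::
    "(nat \<Rightarrow> real) \<Rightarrow> (nat \<Rightarrow> 'h::real_inner set) \<Rightarrow> (nat \<Rightarrow> 'g::real_normed_vector set) \<Rightarrow>
     (nat \<Rightarrow> 'h \<Rightarrow> 'g) \<Rightarrow> real \<Rightarrow> nat \<Rightarrow> nat" where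
  "scaled_complexity s H G Sd \<epsilon> d =
     information_complexity (H d) (scaled_norm (s d)) (G d) (Sd d) \<epsilon>"

definition ell_scaling_condition :: "(nat \<Rightarrow> real) \<Rightarrow> (nat \<Rightarrow> real) \<Rightarrow> real \<Rightarrow> bool" where
  "ell_scaling_condition s lam \<tau> \<longleftrightarrow>
     0 < \<tau> \<and> in_ell \<tau> lam \<and> (SUP d\<in>{1..}. ereal (s d * ell_norm \<tau> lam ^ d)) < \<infinity>"

end

theory Submission
  imports Defs
begin

text \<open>
  Let \<open>v\<^sub>m\<close> be orthonormal eigenvectors of \<open>S\<^sub>1\<^sup>\<dagger> S\<^sub>1\<close> for the positive \<open>\<lambda>\<^sub>m\<close>. The tensors
  \<open>v\<^bsub>j 0\<^esub> \<otimes> \<dots> \<otimes> v\<^bsub>j (d-1)\<^esub>\<close> are singular vectors of \<open>S\<^sub>d\<close>, and expanding elementary tensors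
  shows that they exhaust it, so that \<open>n(\<epsilon>, d)\<close> is the number of \<open>j\<close> with
  \<open>s\<^sub>d \<Prod>\<^sub>i \<lambda>\<^bsub>j i\<^esub> > \<epsilon>\<^sup>2\<close>. Since \<open>\<Sum>\<^sub>j (\<Prod>\<^sub>i \<lambda>\<^bsub>j i\<^esub>)\<^sup>\<tau> = \<parallel>\<lambda>\<parallel>\<^sub>\<tau>\<^bsup>\<tau>d\<^esup>\<close>, Markov's inequality turns (III) into
  \<open>n(\<epsilon>, d) \<le> C \<epsilon>\<^bsup>-2\<tau>\<^esup>\<close>. Conversely, polynomial tractability with exponents \<open>p, q\<close> forces
  \<open>s\<^sub>d \<lambda>\<^sub>1\<^sup>d\<close> to be bounded, because of the binomially many products containing a few factors
  \<open>\<lambda>\<^sub>2\<close>, and then a dyadic summation gives \<open>(s\<^sub>d \<parallel>\<lambda>\<parallel>\<^sub>\<tau>\<^sup>d)\<^sup>\<tau> \<le> K d\<^sup>q\<close> for all \<open>\<tau> > p/2\<close>. Taking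
  \<open>d\<close>-th roots yields (IV), as \<open>\<parallel>\<lambda>\<parallel>\<^sub>\<tau> > \<lambda>\<^sub>1\<close>; and (IV) implies (III) since
  \<open>\<parallel>\<lambda>\<parallel>\<^sub>\<tau> \<rightarrow> \<lambda>\<^sub>1\<close> as \<open>\<tau> \<rightarrow> \<infinity>\<close>. For \<open>q = 0\<close> the dyadic bound is (III) for every \<open>\<tau> > p/2\<close>.
\<close>

subsection \<open>Singular value decomposition of a compact operator\<close>

lemma quadratic_nonneg_imp_linear_zero:
  fixes b c :: real
  assumes "\<And>t. 0 \<le> 2 * t * b + t\<^sup>2 * c"
  shows "b = 0"
proof (rule ccontr)
  assume b: "b \<noteq> 0"
  \<comment> \<open>The test point is \<open>t = - b * k\<close>: its sign makes the linear term
    negative, and \<open>k * c < 1\<close> keeps the quadratic term from compensating it.\<close>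
  define k where "k = 1 / (1 + \<bar>c\<bar>)"
  have k: "k > 0" "k * c < 1"
    unfolding k_def by (auto simp: field_simps)
  have "2 * (- b * k) * b + (- b * k)\<^sup>2 * c = - (b\<^sup>2 * k) * (2 - k * c)"
    by (simp add: power2_eq_square algebra_simps)
  also have "\<dots> < 0"
    using b k by (intro mult_neg_pos) auto
  finally show False
    using assms[of "- b * k"] by simp
qed

text \<open>The representing vector minimises \<open>x \<bullet> x - 2 * \<phi> x\<close>.\<close>
lemma riesz_representation:
  fixes \<phi> :: "'a::{real_inner, complete_space} \<Rightarrow> real"
  assumes "bounded_linear \<phi>"
  shows "\<exists>u. \<forall>x. \<phi> x = x \<bullet> u"
proof -
  interpret \<phi>: bounded_linear \<phi> by fact
  define J where "J x = x \<bullet> x - 2 * \<phi> x" for x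
  obtain K where K: "\<And>x. norm (\<phi> x) \<le> norm x * K"
    using \<phi>.bounded by blast
  have bdd: "- K\<^sup>2 \<le> J x" for x
  proof -
    have "2 * \<phi> x \<le> 2 * (norm x * K)"
      using K[of x] by simp
    also have "\<dots> \<le> (norm x)\<^sup>2 + K\<^sup>2"
      using sum_squares_bound[of "norm x" K] by simp
    finally show ?thesis
      by (simp add: J_def power2_norm_eq_inner)
  qed
  define m where "m = Inf (range J)"
  have bddb: "bdd_below (range J)"
    using bdd by (auto simp: bdd_below_def)
  have m_le: "m \<le> J x" for x
    unfolding m_def using bddb by (rule cInf_lower[rotated]) simp
  have "\<exists>x. J x < m + 1 / (real n + 1)" for n
  proof -
    have "Inf (range J) < m + 1 / (real n + 1)"
      unfolding m_def by simp
    then show ?thesis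
      using cInf_lessD[of "range J"] by auto
  qed
  then obtain X where X: "\<And>n. J (X n) < m + 1 / (real n + 1)"
    by metis
  \<comment> \<open>Parallelogram law: the midpoint has value at least \<open>m\<close>, so two
    near-minimisers of \<open>J\<close> are close to each other.\<close>
  have mid: "(norm (x - y))\<^sup>2 \<le> 2 * (J x - m) + 2 * (J y - m)" for x y
  proof -
    have "J ((1/2) *\<^sub>R (x + y)) = (J x + J y) / 2 - (norm (x - y))\<^sup>2 / 4"
      unfolding J_def power2_norm_eq_inner \<phi>.scaleR \<phi>.add
      by (simp add: inner_add inner_diff inner_commute field_simps)
    then show ?thesis
      using m_le[of "(1/2) *\<^sub>R (x + y)"] by argo
  qed
  have "Cauchy X"
  proof (rule metric_CauchyI)
    fix e :: real
    assume e: "e > 0"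
    obtain N where N: "4 / (real N + 1) < e\<^sup>2"
    proof -
      obtain N where "4 / e\<^sup>2 < real N"
        using reals_Archimedean2 by blast
      with e have "4 / (real N + 1) < e\<^sup>2"
        by (simp add: field_simps) (smt (verit) mult_nonneg_nonneg zero_le_power2)
      then show ?thesis by (rule that)
    qed
    have "dist (X i) (X j) < e" if "i \<ge> N" "j \<ge> N" for i j
    proof -
      have 1: "1 / (real i + 1) \<le> 1 / (real N + 1)" "1 / (real j + 1) \<le> 1 / (real N + 1)"
        using that by (auto simp: field_simps)
      have "(norm (X i - X j))\<^sup>2 < e\<^sup>2"
        using mid[of "X i" "X j"] X[of i] X[of j] 1 N by argo
      then show ?thesis
        using e by (simp add: dist_norm power2_less_imp_less)
    qed
    then show "\<exists>M. \<forall>i\<ge>M. \<forall>j\<ge>M. dist (X i) (X j) < e" by blast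
  qed
  then obtain u where u: "X \<longlonglongrightarrow> u"
    using Cauchy_convergent convergent_def by blast
  have Ju: "J u \<le> m"
  proof (rule LIMSEQ_le)
    show "(\<lambda>n. J (X n)) \<longlonglongrightarrow> J u"
      unfolding J_def by (intro tendsto_intros u \<phi>.tendsto)
    show "(\<lambda>n. m + 1 / (real n + 1)) \<longlonglongrightarrow> m"
      using tendsto_add[OF tendsto_const[of m] LIMSEQ_inverse_real_of_nat]
      by (simp add: inverse_eq_divide add.commute)
    show "\<exists>N. \<forall>n\<ge>N. J (X n) \<le> m + 1 / (real n + 1)"
      using X less_imp_le by blast
  qed
  \<comment> \<open>Stationarity at the minimiser: \<open>J (u + t *\<^sub>R h) - J u\<close> is a
    nonnegative quadratic in \<open>t\<close>, so its linear coefficient vanishes.\<close>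
  have "\<phi> h = h \<bullet> u" for h
  proof -
    have "0 \<le> 2 * t * (h \<bullet> u - \<phi> h) + t\<^sup>2 * (h \<bullet> h)" for t
    proof -
      have "J (u + t *\<^sub>R h) - J u = 2 * t * (h \<bullet> u - \<phi> h) + t\<^sup>2 * (h \<bullet> h)"
        unfolding J_def \<phi>.scaleR \<phi>.add
        by (simp add: inner_add inner_commute algebra_simps power2_eq_square)
      then show ?thesis
        using Ju m_le[of "u + t *\<^sub>R h"] by linarith
    qed
    from quadratic_nonneg_imp_linear_zero[OF this] show ?thesis by simp
  qed
  then show ?thesis by blast
qed

text \<open>The operator \<open>adjoint S\<close> is defined by choice. Riesz representation of the
  functionals \<open>\<lambda>x. S x \<bullet> y\<close> provides a map with the adjoint property,
  so the choice has it as well.\<close>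

lemma adjoint_bounded_linear:
  fixes S :: "'a::{real_inner, complete_space} \<Rightarrow> 'b::real_inner"
  assumes "bounded_linear S"
  shows "S x \<bullet> y = x \<bullet> adjoint S y"
proof -
  have "\<exists>u. \<forall>x. S x \<bullet> y = x \<bullet> u" for y
    by (rule riesz_representation)
       (rule bounded_linear_compose[OF bounded_linear_inner_left assms])
  then obtain g where g: "\<forall>x y. S x \<bullet> y = x \<bullet> g y"
    by metis
  then show ?thesis
    using adjoint_unique[OF g] by simp
qed

lemma bounded_linear_adjoint:
  fixes S :: "'a::{real_inner, complete_space} \<Rightarrow> 'b::real_inner"
  assumes "bounded_linear S"
  shows "bounded_linear (adjoint S)"
proof -
  interpret S: bounded_linear S by fact
  have adj: "S x \<bullet> y = x \<bullet> adjoint S y" for x y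
    using adjoint_bounded_linear[OF assms] .
  obtain K where K: "\<And>x. norm (S x) \<le> norm x * K" "K > 0"
    using S.pos_bounded by blast
  have adj_norm: "norm (adjoint S y) \<le> K * norm y" for y
  proof (cases "adjoint S y = 0")
    case False
    have "(norm (adjoint S y))\<^sup>2 = S (adjoint S y) \<bullet> y"
      by (simp add: adj power2_norm_eq_inner)
    also have "\<dots> \<le> norm (S (adjoint S y)) * norm y"
      by (rule norm_cauchy_schwarz)
    also have "\<dots> \<le> norm (adjoint S y) * K * norm y"
      by (intro mult_right_mono K) simp
    finally show ?thesis
      using False by (simp add: power2_eq_square)
  qed (use K in simp)
  have adj_add: "adjoint S (y + z) = adjoint S y + adjoint S z" for y z
    by (rule vector_eq_ldot[THEN iffD1]) (simp add: adj[symmetric] inner_add)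
  have adj_scale: "adjoint S (c *\<^sub>R y) = c *\<^sub>R adjoint S y" for y c
    by (rule vector_eq_ldot[THEN iffD1]) (simp add: adj[symmetric])
  show ?thesis
    by (rule bounded_linear_intro[of _ K]) (auto simp: adj_add adj_scale adj_norm mult.commute)
qed

section \<open>Compactness and extremal eigenvectors\<close>

lemma compact_operator_bounded_linear:
  assumes "compact_operator S"
  shows "bounded_linear S"
proof -
  have lin: "linear S" and "compact (closure (S ` cball 0 1))"
    using assms by (auto simp: compact_operator_def)
  then have "bounded (S ` cball 0 1)"
    using compact_imp_bounded bounded_subset closure_subset by blast
  then obtain K where K: "\<And>x. norm x \<le> 1 \<Longrightarrow> norm (S x) \<le> K"
    unfolding bounded_iff by (metis image_eqI mem_cball_0)
  have "norm (S x) \<le> norm x * K" for x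
  proof (cases "x = 0")
    case True
    then show ?thesis using linear_0[OF lin] by simp
  next
    case False
    then show ?thesis
      using K[of "(1 / norm x) *\<^sub>R x"] by (simp add: linear_scale[OF lin] field_simps)
  qed
  then show ?thesis
    using lin by (intro bounded_linear_intro[of S K]) (auto simp: linear_add linear_scale)
qed

lemma compact_operator_convergent_subseq:
  fixes X :: "nat \<Rightarrow> 'a::real_normed_vector"
  assumes "compact_operator S" and "\<And>n. norm (X n) \<le> 1"
  obtains r y where "strict_mono r" "(\<lambda>n. S (X (r n))) \<longlonglongrightarrow> y"
proof -
  have comp: "seq_compact (closure (S ` cball 0 1))"
    using assms(1) by (auto simp: compact_operator_def compact_imp_seq_compact)
  have "\<forall>n. S (X n) \<in> closure (S ` cball 0 1)"
    using assms(2) by (intro allI subsetD[OF closure_subset] imageI) simp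
  from comp[unfolded seq_compact_def, THEN spec, THEN mp, OF this]
  obtain l r where "strict_mono r" "((\<lambda>n. S (X n)) \<circ> r) \<longlonglongrightarrow> l"
    by auto
  then show ?thesis
    using that[of r l] by (simp add: o_def)
qed

text \<open>Orthogonal images of squared norm at least \<open>\<delta>\<close> are at distance at
  least \<open>sqrt (2 * \<delta>)\<close>, so no sequence of distinct indices has Cauchy images.
  This yields both the finiteness of orthonormal sets in an eigenspace and
  \<open>lam \<longlonglongrightarrow> 0\<close>.\<close>

lemma finite_orthonormal_image_bounded_below:
  fixes S :: "'a::real_inner \<Rightarrow> 'b::real_inner"
  assumes S: "compact_operator S" and "0 < \<delta>"
    and unit: "\<And>i. i \<in> I \<Longrightarrow> norm (v i) \<le> 1"
    and orth: "\<And>i j. i \<in> I \<Longrightarrow> j \<in> I \<Longrightarrow> i \<noteq> j \<Longrightarrow> S (v i) \<bullet> S (v j) = 0"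
    and below: "\<And>i. i \<in> I \<Longrightarrow> \<delta> \<le> (norm (S (v i)))\<^sup>2"
  shows "finite I"
proof (rule ccontr)
  assume "infinite I"
  then obtain f :: "nat \<Rightarrow> _" where f: "inj f" "range f \<subseteq> I"
    using infinite_countable_subset by blast
  have unit_f: "norm (v (f n)) \<le> 1" for n
    using f unit by blast
  obtain r y where r: "strict_mono r" and lim: "(\<lambda>n. S (v (f (r n)))) \<longlonglongrightarrow> y"
    by (rule compact_operator_convergent_subseq[OF S, of "\<lambda>n. v (f n)", OF unit_f])
  have "Cauchy (\<lambda>n. S (v (f (r n))))"
    using lim LIMSEQ_imp_Cauchy by blast
  then obtain N where N: "\<forall>m\<ge>N. \<forall>n\<ge>N. dist (S (v (f (r m)))) (S (v (f (r n)))) < sqrt \<delta>"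
    unfolding Cauchy_def using \<open>0 < \<delta>\<close> by (metis real_sqrt_gt_zero)
  define a b where "a = f (r N)" and "b = f (r (Suc N))"
  have ab: "a \<in> I" "b \<in> I" "a \<noteq> b"
    using f r by (auto simp: a_def b_def inj_eq strict_mono_eq)
  have "(norm (S (v a) - S (v b)))\<^sup>2 = (norm (S (v a)))\<^sup>2 + (norm (S (v b)))\<^sup>2"
    unfolding power2_norm_eq_inner
    using orth[of a b] ab by (simp add: inner_diff inner_commute)
  moreover have "norm (S (v a) - S (v b)) < sqrt \<delta>"
    using N by (auto simp: a_def b_def dist_norm)
  then have "(norm (S (v a) - S (v b)))\<^sup>2 < (sqrt \<delta>)\<^sup>2"
    by (intro power_strict_mono) auto
  ultimately show False
    using below[OF ab(1)] below[OF ab(2)] \<open>0 < \<delta>\<close> by simp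
qed

text \<open>A maximal orthonormal subset of \<open>E\<close> exists by Zorn's lemma; being finite, it spans.\<close>
lemma finite_orthonormal_basis:
  fixes E :: "'a::real_inner set"
  assumes E: "subspace E"
    and fin: "\<And>B. B \<subseteq> E \<Longrightarrow> pairwise orthogonal B \<Longrightarrow> (\<forall>b\<in>B. norm b = 1) \<Longrightarrow> finite B"
  obtains B where "finite B" "B \<subseteq> E" "pairwise orthogonal B" "\<forall>b\<in>B. norm b = 1" "span B = E"
proof -
  define \<A> where "\<A> = {B. B \<subseteq> E \<and> pairwise orthogonal B \<and> (\<forall>b\<in>B. norm b = 1)}"
  have "\<exists>M\<in>\<A>. \<forall>X\<in>\<A>. M \<subseteq> X \<longrightarrow> X = M"
  proof (rule subset_Zorn')
    fix C assume C: "subset.chain \<A> C"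
    have "orthogonal x y" if xy: "x \<in> \<Union>C" "y \<in> \<Union>C" "x \<noteq> y" for x y
    proof -
      obtain A B where AB: "A \<in> C" "B \<in> C" "x \<in> A" "y \<in> B"
        using xy by blast
      then have "A \<subseteq> B \<or> B \<subseteq> A"
        using C unfolding subset_chain_def by blast
      then obtain D where "D \<in> C" "x \<in> D" "y \<in> D"
        using AB by blast
      moreover have "D \<in> \<A>"
        using C \<open>D \<in> C\<close> unfolding subset_chain_def by blast
      ultimately show ?thesis
        using xy(3) unfolding \<A>_def pairwise_def by blast
    qed
    moreover have "\<Union>C \<subseteq> E" "\<forall>b\<in>\<Union>C. norm b = 1"
      using C unfolding subset_chain_def \<A>_def by blast+
    ultimately show "\<Union>C \<in> \<A>"
      unfolding \<A>_def pairwise_def by blast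
  qed
  then obtain B where "B \<in> \<A>" and max: "\<And>X. X \<in> \<A> \<Longrightarrow> B \<subseteq> X \<Longrightarrow> X = B"
    by blast
  then have B: "B \<subseteq> E" "pairwise orthogonal B" "\<forall>b\<in>B. norm b = 1"
    by (auto simp: \<A>_def)
  then have finB: "finite B"
    by (rule fin)
  have "x \<in> span B" if "x \<in> E" for x
  proof (rule ccontr)
    assume nx: "x \<notin> span B"
    \<comment> \<open>Gram-Schmidt: the normalised residual of \<open>x\<close> would enlarge the
      maximal set \<open>B\<close>.\<close>
    define y where "y = x - (\<Sum>b\<in>B. (x \<bullet> b) *\<^sub>R b)"
    have sum_in: "(\<Sum>b\<in>B. (x \<bullet> b) *\<^sub>R b) \<in> span B"
      by (intro span_sum span_scale span_base)
    have "y \<noteq> 0"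
      using nx sum_in by (auto simp: y_def)
    have "span B \<subseteq> E"
      using B(1) E span_minimal by blast
    then have "y \<in> E"
      unfolding y_def using sum_in that E by (auto intro: subspace_diff)
    have yorth: "y \<bullet> b = 0" if "b \<in> B" for b
    proof -
      have "(\<Sum>c\<in>B. (x \<bullet> c) * (c \<bullet> b)) = (\<Sum>c\<in>B. if c = b then x \<bullet> b else 0)"
        using B(2,3) that
        by (intro sum.cong) (auto simp: pairwise_def orthogonal_def norm_eq_1)
      then show ?thesis
        using finB that by (simp add: y_def inner_diff_left inner_sum_left)
    qed
    define z where "z = (1 / norm y) *\<^sub>R y"
    have z: "norm z = 1" "z \<in> E"
      using \<open>y \<noteq> 0\<close> \<open>y \<in> E\<close> E by (auto simp: z_def subspace_scale)
    have "pairwise orthogonal (insert z B)"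
      using B(2) yorth
      by (auto simp: pairwise_insert orthogonal_def z_def inner_commute)
    then have "insert z B \<in> \<A>"
      using B z by (auto simp: \<A>_def)
    then have "z \<in> B"
      using max by blast
    then have "y \<bullet> z = 0"
      by (rule yorth)
    then show False using \<open>y \<noteq> 0\<close> by (simp add: z_def)
  qed
  then have "span B = E"
    using B(1) E span_minimal by blast
  with that finB B show ?thesis by blast
qed

text \<open>A unit vector maximising \<open>norm (S x)\<close> over the unit ball of \<open>M\<close> is an eigenvector.\<close>
lemma largest_eigenvector_on_invariant_subspace:
  fixes S :: "'a::{real_inner, complete_space} \<Rightarrow> 'b::{real_inner, complete_space}"
  assumes S: "compact_operator S"
    and M: "subspace M" "closed M" "\<And>x. x \<in> M \<Longrightarrow> adjoint S (S x) \<in> M"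
    and x0: "x0 \<in> M" "S x0 \<noteq> 0"
  obtains u \<mu> where "u \<in> M" "u \<noteq> 0" "\<mu> > 0" "adjoint S (S u) = \<mu> *\<^sub>R u"
    "\<And>y. y \<in> M \<Longrightarrow> (norm (S y))\<^sup>2 \<le> \<mu> * (norm y)\<^sup>2"
proof -
  have bl: "bounded_linear S"
    using S by (rule compact_operator_bounded_linear)
  interpret S: bounded_linear S by fact
  let ?T = "\<lambda>x. adjoint S (S x)"
  have adj: "S x \<bullet> y = x \<bullet> adjoint S y" for x y
    using adjoint_bounded_linear[OF bl] .
  have bladj: "bounded_linear (adjoint S)"
    by (rule bounded_linear_adjoint[OF bl])
  obtain K where K: "\<And>x. norm (S x) \<le> norm x * K" "K > 0"
    using S.pos_bounded by blast
  define D where "D = {x \<in> M. norm x \<le> 1}"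
  define \<sigma> where "\<sigma> = (SUP x\<in>D. norm (S x))"
  have "0 \<in> D"
    using M(1) by (simp add: D_def subspace_0)
  have le_K: "norm (S x) \<le> K" if "x \<in> D" for x
  proof -
    have "norm (S x) \<le> norm x * K" by (rule K)
    also have "\<dots> \<le> 1 * K"
      using that K(2) by (intro mult_right_mono) (auto simp: D_def)
    finally show ?thesis by simp
  qed
  have bdd: "bdd_above ((\<lambda>x. norm (S x)) ` D)"
    using le_K by (auto simp: bdd_above_def)
  have le_\<sigma>D: "norm (S x) \<le> \<sigma>" if "x \<in> D" for x
    unfolding \<sigma>_def using bdd that by (rule cSUP_upper2) simp
  have le_\<sigma>: "norm (S y) \<le> \<sigma> * norm y" if "y \<in> M" for y
  proof (cases "y = 0")
    case True
    then show ?thesis by (simp add: S.zero)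
  next
    case False
    have "(1 / norm y) *\<^sub>R y \<in> D"
      using that False M(1) by (auto simp: D_def subspace_scale)
    from le_\<sigma>D[OF this] False show ?thesis
      by (simp add: S.scaleR field_simps)
  qed
  have "\<sigma> > 0"
  proof (rule ccontr)
    assume "\<not> 0 < \<sigma>"
    then have "\<sigma> * norm x0 \<le> 0"
      by (simp add: mult_nonpos_nonneg)
    then show False
      using le_\<sigma>[OF x0(1)] x0(2) by (metis norm_le_zero_iff order_trans)
  qed
  have "\<exists>x\<in>D. \<sigma> - 1 / (real n + 1) < norm (S x)" for n
  proof -
    have "\<sigma> - 1 / (real n + 1) < \<sigma>" by simp
    then show ?thesis
      unfolding \<sigma>_def using less_cSUP_iff[OF _ bdd] \<open>0 \<in> D\<close> by blast
  qed
  then obtain X where X: "\<And>n. X n \<in> D" "\<And>n. \<sigma> - 1 / (real n + 1) < norm (S (X n))"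
    by metis
  have lim\<sigma>: "(\<lambda>n. norm (S (X n))) \<longlonglongrightarrow> \<sigma>"
  proof (rule tendsto_sandwich)
    show "(\<lambda>n. \<sigma> - 1 / (real n + 1)) \<longlonglongrightarrow> \<sigma>"
      using tendsto_diff[OF tendsto_const[of \<sigma>] LIMSEQ_inverse_real_of_nat]
      by (simp add: inverse_eq_divide add.commute)
    show "(\<lambda>n. \<sigma>) \<longlonglongrightarrow> \<sigma>" by simp
  qed (use X le_\<sigma>D in \<open>auto intro!: always_eventually less_imp_le\<close>)
  have X1: "norm (X n) \<le> 1" for n
    using X(1)[of n] by (simp add: D_def)
  obtain r y where r: "strict_mono r" and lim: "(\<lambda>n. S (X (r n))) \<longlonglongrightarrow> y"
    by (rule compact_operator_convergent_subseq[OF S, of X, OF X1])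
  define z where "z = adjoint S y"
  have limT: "(\<lambda>n. ?T (X (r n))) \<longlonglongrightarrow> z"
    unfolding z_def by (rule bounded_linear.tendsto[OF bladj lim])
  have lim\<sigma>r: "(\<lambda>n. norm (S (X (r n)))) \<longlonglongrightarrow> \<sigma>"
    using LIMSEQ_subseq_LIMSEQ[OF lim\<sigma> r] by (simp add: o_def)
  \<comment> \<open>Invariance of \<open>M\<close> allows \<open>le_\<sigma>\<close> to be applied
    to \<open>?T x\<close> itself; after Cauchy-Schwarz one factor \<open>norm (?T x)\<close>
    cancels.\<close>
  have T_le: "norm (?T x) \<le> \<sigma> * norm (S x)" if "x \<in> M" for x
  proof (cases "?T x = 0")
    case True
    then show ?thesis using \<open>\<sigma> > 0\<close> by simp
  next
    case False
    have "(norm (?T x))\<^sup>2 = S (?T x) \<bullet> S x"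
      by (simp add: adj power2_norm_eq_inner)
    also have "\<dots> \<le> norm (S (?T x)) * norm (S x)"
      by (rule norm_cauchy_schwarz)
    also have "\<dots> \<le> (\<sigma> * norm (?T x)) * norm (S x)"
      by (intro mult_right_mono le_\<sigma> M that) simp
    finally show ?thesis
      using False by (simp add: power2_eq_square)
  qed
  define \<mu> where "\<mu> = \<sigma>\<^sup>2"
  \<comment> \<open>Expand the square; both \<open>(norm (?T x))\<^sup>2\<close> and
    \<open>\<mu>\<^sup>2 * (norm x)\<^sup>2\<close> are at most \<open>\<mu>\<^sup>2\<close>. Hence
    a maximising sequence consists of approximate eigenvectors for \<open>\<mu>\<close>.\<close>
  have near: "(norm (?T x - \<mu> *\<^sub>R x))\<^sup>2 \<le> 2 * \<mu> * (\<mu> - (norm (S x))\<^sup>2)" if "x \<in> D" for x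
  proof -
    have xM: "x \<in> M" "norm x \<le> 1" using that by (auto simp: D_def)
    have "norm (?T x) \<le> \<sigma> * norm (S x)"
      by (rule T_le[OF xM(1)])
    also have "\<dots> \<le> \<sigma> * \<sigma>"
      using \<open>\<sigma> > 0\<close> le_\<sigma>D[OF that] by (intro mult_left_mono) auto
    finally have "(norm (?T x))\<^sup>2 \<le> \<mu>\<^sup>2"
      by (intro power_mono) (auto simp: \<mu>_def power2_eq_square)
    moreover have "\<mu>\<^sup>2 * (norm x)\<^sup>2 \<le> \<mu>\<^sup>2"
      using xM(2) by (intro mult_left_le) (auto simp: power_le_one)
    moreover have "(norm (?T x - \<mu> *\<^sub>R x))\<^sup>2 = (norm (?T x))\<^sup>2 - 2 * \<mu> * (norm (S x))\<^sup>2 + \<mu>\<^sup>2 * (norm x)\<^sup>2"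
      unfolding power2_norm_eq_inner adj[of x "S x"]
      by (simp add: inner_diff inner_commute algebra_simps power2_eq_square)
    ultimately show ?thesis
      by (simp add: algebra_simps power2_eq_square)
  qed
  \<comment> \<open>Compactness alone gives convergence of the images only. As the eigenvector
    defect vanishes and \<open>?T (X (r n))\<close> converges, the vectors \<open>X (r n)\<close>
    converge too.\<close>
  have "(\<lambda>n. ?T (X (r n)) - \<mu> *\<^sub>R X (r n)) \<longlonglongrightarrow> 0"
  proof -
    have "(\<lambda>n. 2 * \<mu> * (\<mu> - (norm (S (X (r n))))\<^sup>2)) \<longlonglongrightarrow> 2 * \<mu> * (\<mu> - \<sigma>\<^sup>2)"
      by (intro tendsto_intros lim\<sigma>r)
    then have l0: "(\<lambda>n. 2 * \<mu> * (\<mu> - (norm (S (X (r n))))\<^sup>2)) \<longlonglongrightarrow> 0"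
      by (simp add: \<mu>_def)
    have "(\<lambda>n. (norm (?T (X (r n)) - \<mu> *\<^sub>R X (r n)))\<^sup>2) \<longlonglongrightarrow> 0"
      by (rule tendsto_sandwich[OF _ _ tendsto_const l0]) (use near X in auto)
    from tendsto_real_sqrt[OF this] show ?thesis
      by (simp add: tendsto_norm_zero_iff)
  qed
  from tendsto_diff[OF limT this] have "(\<lambda>n. \<mu> *\<^sub>R X (r n)) \<longlonglongrightarrow> z"
    by simp
  from tendsto_scaleR[OF tendsto_const[of "1 / \<mu>"] this]
  have limX: "(\<lambda>n. X (r n)) \<longlonglongrightarrow> (1 / \<mu>) *\<^sub>R z"
    using \<open>\<sigma> > 0\<close> by (simp add: \<mu>_def)
  define u where "u = (1 / \<mu>) *\<^sub>R z"
  have "\<mu> > 0" using \<open>\<sigma> > 0\<close> by (simp add: \<mu>_def)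
  have "u \<in> M"
    unfolding u_def
    by (rule closed_sequentially[OF M(2) _ limX]) (use X(1) in \<open>simp add: D_def\<close>)
  moreover have "norm (S u) = \<sigma>"
    using LIMSEQ_unique[OF lim\<sigma>r tendsto_norm[OF S.tendsto[OF limX]]]
    by (simp add: u_def)
  then have "u \<noteq> 0"
    using \<open>\<sigma> > 0\<close> by (auto simp: S.zero)
  moreover have "?T u = z"
    using LIMSEQ_unique[OF limT bounded_linear.tendsto[OF bladj S.tendsto[OF limX]]]
    by (simp add: u_def)
  then have "?T u = \<mu> *\<^sub>R u"
    using \<open>\<mu> > 0\<close> by (simp add: u_def)
  moreover have "(norm (S y))\<^sup>2 \<le> \<mu> * (norm y)\<^sup>2" if "y \<in> M" for y
    using power_mono[OF le_\<sigma>[OF that], of 2] by (simp add: \<mu>_def power_mult_distrib)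
  ultimately show ?thesis
    using that \<open>\<mu> > 0\<close> by blast
qed


text \<open>Orthonormal bases of the eigenspaces are indexed by the positions of their eigenvalue in
  \<open>lam\<close>. The third property bounds the error of the truncated singular value expansion:
  on the complement of the eigenvectors with index below \<open>M\<close>, no eigenvalue exceeds
  \<open>lam M\<close>.\<close>

theorem compact_operator_singular_system:
  fixes S :: "'a::{real_inner, complete_space} \<Rightarrow> 'b::{real_inner, complete_space}"
  assumes S: "compact_operator S" and lam: "eigenvalue_sequence (adjoint S \<circ> S) lam"
  obtains v where
    "\<And>m k. 0 < lam m \<Longrightarrow> 0 < lam k \<Longrightarrow> v m \<bullet> v k = (if m = k then 1 else 0)"
    "\<And>m k. 0 < lam m \<Longrightarrow> 0 < lam k \<Longrightarrow> S (v m) \<bullet> S (v k) = (if m = k then lam m else 0)"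
    "\<And>M x. (norm (S x - (\<Sum>m | m < M \<and> 0 < lam m. (x \<bullet> v m) *\<^sub>R S (v m))))\<^sup>2 \<le> lam M * (norm x)\<^sup>2"
    "lam \<longlonglongrightarrow> 0"
proof -
  have bl: "bounded_linear S"
    using S by (rule compact_operator_bounded_linear)
  interpret S: bounded_linear S by fact
  interpret T: bounded_linear "\<lambda>x. adjoint S (S x)"
    by (rule bounded_linear_compose[OF bounded_linear_adjoint[OF bl] bl])
  have dec: "\<And>m n. m \<le> n \<Longrightarrow> lam n \<le> lam m" and nonneg: "\<And>m. 0 \<le> lam m"
    using lam by (auto simp: eigenvalue_sequence_def decseq_def)
  define E where "E \<mu> = {x. adjoint S (S x) = \<mu> *\<^sub>R x}" for \<mu>
  have SE: "S x \<bullet> S b = \<mu> * (x \<bullet> b)" if "b \<in> E \<mu>" for x b \<mu>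
    using that adjoint_bounded_linear[OF bl, of x "S b"] by (simp add: E_def)
  have subE: "subspace (E \<mu>)" for \<mu>
    by (auto simp: subspace_def E_def T.add T.scaleR T.zero[unfolded S.zero] algebra_simps)
  have "\<exists>B. finite B \<and> B \<subseteq> E \<mu> \<and> pairwise orthogonal B \<and> (\<forall>b\<in>B. norm b = 1) \<and> span B = E \<mu>"
    if "\<mu> > 0" for \<mu>
  proof -
    have fin: "finite B" if B: "B \<subseteq> E \<mu>" "pairwise orthogonal B" "\<forall>b\<in>B. norm b = 1" for B
    proof (rule finite_orthonormal_image_bounded_below[OF S \<open>\<mu> > 0\<close>])
      show "S i \<bullet> S j = 0" if "i \<in> B" "j \<in> B" "i \<noteq> j" for i j
        using B that SE[of j \<mu> i] by (auto simp: pairwise_def orthogonal_def)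
      show "\<mu> \<le> (norm (S i))\<^sup>2" if "i \<in> B" for i
        using B that SE[of i \<mu> i] by (auto simp: power2_norm_eq_inner norm_eq_1)
    qed (use B in auto)
    show ?thesis
      by (rule finite_orthonormal_basis[OF subE[of \<mu>] fin]) auto
  qed
  then obtain B where B: "\<And>\<mu>. \<mu> > 0 \<Longrightarrow> finite (B \<mu>)" "\<And>\<mu>. \<mu> > 0 \<Longrightarrow> B \<mu> \<subseteq> E \<mu>"
    "\<And>\<mu>. \<mu> > 0 \<Longrightarrow> pairwise orthogonal (B \<mu>)"
    "\<And>\<mu> b. \<mu> > 0 \<Longrightarrow> b \<in> B \<mu> \<Longrightarrow> norm b = 1" "\<And>\<mu>. \<mu> > 0 \<Longrightarrow> span (B \<mu>) = E \<mu>"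
    by metis
  \<comment> \<open>Multiplicities match: \<open>\<mu>\<close> occurs \<open>dim (E \<mu>)\<close>
    times in \<open>lam\<close>, and this is the size of the orthonormal basis
    \<open>B \<mu>\<close>.\<close>
  have "\<exists>h. bij_betw h {m. lam m = \<mu>} (B \<mu>)" if \<mu>: "\<mu> > 0" for \<mu>
  proof (rule finite_same_card_bij)
    have "independent (B \<mu>)"
      using B(3)[OF \<mu>] B(4)[OF \<mu>, of 0] by (intro pairwise_orthogonal_independent) auto
    then have "dim (E \<mu>) = card (B \<mu>)"
      using B(5)[OF \<mu>] by (intro dim_eq_card) (auto simp: span_eq_iff[THEN iffD2, OF subE])
    then show "card {m. lam m = \<mu>} = card (B \<mu>)" "finite {m. lam m = \<mu>}"
      using lam \<mu> by (auto simp: eigenvalue_sequence_def E_def o_def)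
  qed (use B \<mu> in auto)
  then obtain h where h: "\<And>\<mu>. \<mu> > 0 \<Longrightarrow> bij_betw (h \<mu>) {m. lam m = \<mu>} (B \<mu>)"
    by metis
  \<comment> \<open>At indices with \<open>lam m = 0\<close> the value is unspecified, which is why
    the properties of \<open>v\<close> are restricted to positive \<open>lam m\<close>.\<close>
  define v where "v m = h (lam m) m" for m
  have vB: "v m \<in> B (lam m)" if "lam m > 0" for m
    using bij_betwE[OF h[OF that]] by (auto simp: v_def)
  have vE: "v m \<in> E (lam m)" if "lam m > 0" for m
    using vB B(2) that by blast
  have B_sub: "B \<mu> \<subseteq> v ` {m. lam m = \<mu>}" if "\<mu> > 0" for \<mu>
    using bij_betw_imp_surj_on[OF h[OF that]] by (auto simp: v_def)
  have on: "v m \<bullet> v k = (if m = k then 1 else 0)" if mk: "0 < lam m" "0 < lam k" for m k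
  proof (cases "lam m = lam k")
    case True
    have "v m = v k \<longleftrightarrow> m = k"
      using inj_onD[OF bij_betw_imp_inj_on[OF h[OF mk(1)]], of m k] True by (auto simp: v_def)
    moreover have "norm (v m) = 1"
      using B(4) vB mk by blast
    ultimately show ?thesis
      using B(3)[OF mk(1)] vB[OF mk(1)] vB[OF mk(2)] True
      by (auto simp: pairwise_def orthogonal_def norm_eq_1)
  next
    case False
    have "lam k * (v m \<bullet> v k) = S (v m) \<bullet> S (v k)"
      using SE[OF vE[OF mk(2)], of "v m"] by simp
    also have "\<dots> = lam m * (v m \<bullet> v k)"
      using SE[OF vE[OF mk(1)], of "v k"] by (simp add: inner_commute)
    finally have "lam k * (v m \<bullet> v k) = lam m * (v m \<bullet> v k)" .
    with False show ?thesis by auto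
  qed
  have Sv: "S (v m) \<bullet> S (v k) = (if m = k then lam m else 0)" if "0 < lam m" "0 < lam k" for m k
    using SE[OF vE[OF that(2)], of "v m"] on[OF that] by auto
  have fin\<delta>: "finite {m. \<delta> \<le> lam m}" if "\<delta> > 0" for \<delta>
  proof (rule finite_orthonormal_image_bounded_below[OF S that, where v = v])
    fix i assume "i \<in> {m. \<delta> \<le> lam m}"
    then have i: "lam i > 0" "\<delta> \<le> lam i" using that by auto
    show "norm (v i) \<le> 1"
      using i on[of i i] by (simp add: norm_eq_sqrt_inner)
    show "\<delta> \<le> (norm (S (v i)))\<^sup>2"
      using i Sv[of i i] by (simp add: power2_norm_eq_inner)
    fix j assume "j \<in> {m. \<delta> \<le> lam m}" "i \<noteq> j"
    then show "S (v i) \<bullet> S (v j) = 0"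
      using i Sv[of i j] that by auto
  qed
  have lim0: "lam \<longlonglongrightarrow> 0"
  proof (rule LIMSEQ_I)
    fix r :: real assume "r > 0"
    then obtain N where N: "\<And>m. r \<le> lam m \<Longrightarrow> m < N"
      using finite_nat_bounded[OF fin\<delta>[of r]] by auto
    then show "\<exists>no. \<forall>n\<ge>no. norm (lam n - 0) < r"
      using nonneg by (intro exI[of _ N]) (auto simp: not_le[symmetric])
  qed
  have tail: "(norm (S x - (\<Sum>m | m < M \<and> 0 < lam m. (x \<bullet> v m) *\<^sub>R S (v m))))\<^sup>2 \<le> lam M * (norm x)\<^sup>2"
    for M x
  proof -
    define F where "F = {m. m < M \<and> 0 < lam m}"
    define y where "y = x - (\<Sum>m\<in>F. (x \<bullet> v m) *\<^sub>R v m)"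
    have finF: "finite F" by (simp add: F_def)
    \<comment> \<open>\<open>C\<close> is the orthogonal complement of the eigenvectors indexed by
      \<open>F\<close>, a closed invariant subspace. It contains the residual \<open>y\<close>, and
      the truncation error to be estimated is \<open>S y\<close>.\<close>
    define C where "C = {z. \<forall>m\<in>F. z \<bullet> v m = 0}"
    have yC: "y \<in> C"
    proof -
      have "y \<bullet> v k = 0" if "k \<in> F" for k
      proof -
        have "(\<Sum>m\<in>F. (x \<bullet> v m) * (v m \<bullet> v k)) = (\<Sum>m\<in>F. if m = k then x \<bullet> v k else 0)"
          using that on by (intro sum.cong) (auto simp: F_def)
        then show ?thesis
          using finF that by (simp add: y_def inner_diff_left inner_sum_left)
      qed
      then show ?thesis by (simp add: C_def)
    qed
    have "norm y \<le> norm x"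
    proof -
      have "y \<bullet> (\<Sum>m\<in>F. (x \<bullet> v m) *\<^sub>R v m) = 0"
        using yC by (simp add: inner_sum_right C_def)
      then have "(norm x)\<^sup>2 = (norm y)\<^sup>2 + (norm (x - y))\<^sup>2"
        by (simp add: y_def power2_norm_eq_inner inner_diff inner_commute)
      then show ?thesis
        by (simp add: norm_le_square power2_norm_eq_inner)
    qed
    have "(norm (S y))\<^sup>2 \<le> lam M * (norm y)\<^sup>2"
    proof (cases "S y = 0")
      case True
      then show ?thesis using nonneg by simp
    next
      case False
      have subC: "subspace C"
        by (auto simp: C_def subspace_def inner_add_left)
      have closedC: "closed C"
      proof -
        have "C = (\<Inter>m\<in>F. {z. z \<bullet> v m = 0})"
          by (auto simp: C_def)
        also have "closed \<dots>"
          by (intro closed_INT ballI closed_Collect_eq continuous_intros)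
        finally show ?thesis .
      qed
      have invC: "adjoint S (S z) \<in> C" if "z \<in> C" for z
      proof -
        have "adjoint S (S z) \<bullet> v m = 0" if "m \<in> F" for m
        proof -
          have "adjoint S (S z) \<bullet> v m = S z \<bullet> S (v m)"
            using adjoint_bounded_linear[OF bl, of "v m" "S z"] by (simp add: inner_commute)
          also have "\<dots> = lam m * (z \<bullet> v m)"
            using that by (intro SE vE) (simp add: F_def)
          finally show ?thesis
            using that \<open>z \<in> C\<close> by (simp add: C_def)
        qed
        then show ?thesis by (simp add: C_def)
      qed
      obtain u \<mu> where u: "u \<in> C" "u \<noteq> 0" "\<mu> > 0" "adjoint S (S u) = \<mu> *\<^sub>R u"
        and le: "\<And>y. y \<in> C \<Longrightarrow> (norm (S y))\<^sup>2 \<le> \<mu> * (norm y)\<^sup>2"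
        using largest_eigenvector_on_invariant_subspace[OF S subC closedC invC yC False] by blast
      \<comment> \<open>Otherwise every index with eigenvalue \<open>\<mu>\<close> precedes
        \<open>M\<close>, so \<open>C\<close> is orthogonal to the whole eigenspace
        \<open>E \<mu>\<close>, although that space contains the nonzero vector \<open>u\<close> of
        \<open>C\<close>.\<close>
      have "\<mu> \<le> lam M"
      proof (rule ccontr)
        assume "\<not> \<mu> \<le> lam M"
        then have "{m. lam m = \<mu>} \<subseteq> F"
          using dec u(3) by (auto simp: F_def not_le[symmetric])
        have "orthogonal u b" if b: "b \<in> B \<mu>" for b
        proof -
          obtain m where "b = v m" "lam m = \<mu>"
            using b B_sub[OF u(3)] by blast
          then have "m \<in> F"
            using \<open>{m. lam m = \<mu>} \<subseteq> F\<close> by blast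
          then show ?thesis
            using u(1) \<open>b = v m\<close> by (simp add: C_def orthogonal_def)
        qed
        then have "orthogonal u u"
          using B(5)[OF u(3)] u(4) orthogonal_to_span[of u "B \<mu>" u] by (auto simp: E_def)
        with u(2) show False by (simp add: orthogonal_def)
      qed
      then have "\<mu> * (norm y)\<^sup>2 \<le> lam M * (norm y)\<^sup>2"
        by (rule mult_right_mono) simp
      then show ?thesis using le[OF yC] by linarith
    qed
    also have "\<dots> \<le> lam M * (norm x)\<^sup>2"
      using \<open>norm y \<le> norm x\<close> nonneg by (intro mult_left_mono power_mono) auto
    finally show ?thesis
      by (simp add: y_def F_def S.diff S.sum S.scaleR)
  qed
  show ?thesis
    by (rule that[OF on Sv tail lim0])
qed

subsection \<open>Information complexity and singular values\<close>

text \<open>Gaussian elimination of one unknown per equation. It supplies a nonzero input on which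
  all functionals of a linear algorithm vanish.\<close>

lemma underdetermined_homogeneous_system:
  fixes a :: "nat \<Rightarrow> 'j \<Rightarrow> real"
  assumes "finite J" "n < card J"
  shows "\<exists>c. (\<exists>j\<in>J. c j \<noteq> 0) \<and> (\<forall>k<n. (\<Sum>j\<in>J. c j * a k j) = 0)"
  using assms
proof (induction n arbitrary: J a)
  case 0
  then show ?case
    by (intro exI[of _ "\<lambda>_. 1"]) (auto simp: card_gt_0_iff)
next
  case (Suc n)
  show ?case
  proof (cases "\<forall>j\<in>J. a n j = 0")
    case True
    from Suc.IH[of J a] Suc.prems obtain c where
      c: "\<exists>j\<in>J. c j \<noteq> 0" "\<forall>k<n. (\<Sum>j\<in>J. c j * a k j) = 0"
      by auto
    then show ?thesis
      using True by (intro exI[of _ c]) (auto simp: less_Suc_eq)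
  next
    case False
    then obtain p where p: "p \<in> J" "a n p \<noteq> 0" by blast
    define J' where "J' = J - {p}"
    have J': "finite J'" "n < card J'" "J = insert p J'" "p \<notin> J'"
      using Suc.prems p by (auto simp: J'_def)
    from Suc.IH[OF J'(1,2), of "\<lambda>k j. a k j - a k p * a n j / a n p"] obtain c where
      c: "\<exists>j\<in>J'. c j \<noteq> 0" "\<And>k. k < n \<Longrightarrow> (\<Sum>j\<in>J'. c j * (a k j - a k p * a n j / a n p)) = 0"
      by blast
    \<comment> \<open>The value at \<open>p\<close> solves equation \<open>n\<close>; substituting
      it into the other equations gives the coefficients used in the induction hypothesis.\<close>
    define c' where "c' = c(p := - (\<Sum>j\<in>J'. c j * a n j) / a n p)"
    have sum_c': "(\<Sum>j\<in>J. c' j * a k j) = (\<Sum>j\<in>J'. c j * a k j) - a k p / a n p * (\<Sum>j\<in>J'. c j * a n j)" for k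
    proof -
      have "(\<Sum>j\<in>J'. c' j * a k j) = (\<Sum>j\<in>J'. c j * a k j)"
        using J'(4) by (intro sum.cong) (auto simp: c'_def)
      then show ?thesis
        using J'(1,3,4) by (simp add: c'_def)
    qed
    have "(\<Sum>j\<in>J. c' j * a k j) = 0" if "k < Suc n" for k
    proof (cases "k = n")
      case True
      then show ?thesis using p by (simp add: sum_c')
    next
      case False
      with that have "k < n" by simp
      from c(2)[OF this] show ?thesis
        unfolding sum_c' by (simp add: sum_distrib_left right_diff_distrib sum_subtractf mult_ac)
    qed
    moreover have "\<exists>j\<in>J. c' j \<noteq> 0"
      using c(1) J'(3,4) by (auto simp: c'_def)
    ultimately show ?thesis by blast
  qed
qed

section \<open>Linear algorithms and minimal errors\<close>

lemma continuous_linear_on_zero: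
  assumes "continuous_linear_on V N f" "subspace V"
  shows "f 0 = 0"
  using assms subspace_0[of V] unfolding continuous_linear_on_def
  by (metis scaleR_zero_left)

lemma continuous_linear_on_sum:
  assumes f: "continuous_linear_on V N f" and V: "subspace V" and "\<And>j. j \<in> J \<Longrightarrow> e j \<in> V"
  shows "f (\<Sum>j\<in>J. c j *\<^sub>R e j) = (\<Sum>j\<in>J. c j *\<^sub>R f (e j))"
  using assms(3)
proof (induction J rule: infinite_finite_induct)
  case (insert x F)
  have "c x *\<^sub>R e x \<in> V" "(\<Sum>j\<in>F. c j *\<^sub>R e j) \<in> V"
    using insert.prems V by (auto intro!: subspace_sum subspace_scale)
  then show ?case
    using f insert unfolding continuous_linear_on_def by simp
qed (simp_all add: continuous_linear_on_zero[OF f V])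

lemma norm_orthogonal_sum_scaleR:
  fixes e :: "'j \<Rightarrow> 'a::real_inner"
  assumes "finite J" "\<And>i j. i \<in> J \<Longrightarrow> j \<in> J \<Longrightarrow> i \<noteq> j \<Longrightarrow> e i \<bullet> e j = 0"
  shows "(norm (\<Sum>j\<in>J. c j *\<^sub>R e j))\<^sup>2 = (\<Sum>j\<in>J. (c j)\<^sup>2 * (norm (e j))\<^sup>2)"
proof -
  have "(norm (\<Sum>j\<in>J. c j *\<^sub>R e j))\<^sup>2 = (\<Sum>j\<in>J. (norm (c j *\<^sub>R e j))\<^sup>2)"
    using assms by (intro norm_sum_Pythagorean) (auto simp: pairwise_def orthogonal_def)
  then show ?thesis
    by (simp add: power_mult_distrib)
qed

lemma scaled_norm_eq: "s > 0 \<Longrightarrow> scaled_norm s x = norm x / sqrt s"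
  by (simp add: scaled_norm_def scaled_inner_def real_sqrt_divide norm_eq_sqrt_inner)

text \<open>Boundedness is what makes the real-valued \<open>SUP\<close> in
  \<open>worst_case_error\<close> an upper bound. It holds since \<open>R\<close> and each
  functional are bounded on the scaled unit ball.\<close>

lemma bdd_above_algorithm_error:
  assumes s: "s > 0" and R: "continuous_linear_on V norm R"
    and A: "A \<in> linear_algorithms V (scaled_norm s) W n"
  shows "bdd_above ((\<lambda>f. norm (R f - A f)) ` {f \<in> V. scaled_norm s f \<le> 1})"
proof -
  obtain L g where L: "\<And>j. j < n \<Longrightarrow> continuous_linear_on V (scaled_norm s) (L j)"
    and A_eq: "A = (\<lambda>f. \<Sum>j<n. L j f *\<^sub>R g j)"
    using A unfolding linear_algorithms_def by auto
  have "\<exists>K. \<forall>f\<in>V. \<bar>L j f\<bar> \<le> K * scaled_norm s f" if "j < n" for j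
    using L[OF that] by (simp add: continuous_linear_on_def)
  then obtain K where K: "\<And>j f. j < n \<Longrightarrow> f \<in> V \<Longrightarrow> \<bar>L j f\<bar> \<le> K j * scaled_norm s f"
    by metis
  obtain KR where KR: "\<And>f. f \<in> V \<Longrightarrow> norm (R f) \<le> KR * norm f"
    using R unfolding continuous_linear_on_def by blast
  have "norm (R f - A f) \<le> \<bar>KR\<bar> * sqrt s + (\<Sum>j<n. \<bar>K j\<bar> * norm (g j))"
    if f: "f \<in> V" "scaled_norm s f \<le> 1" for f
  proof -
    have nf: "norm f \<le> sqrt s"
      using f(2) s by (simp add: scaled_norm_eq)
    have "norm (R f) \<le> \<bar>KR\<bar> * norm f"
      using KR[OF f(1)] by (smt (verit) mult_right_mono norm_ge_zero)
    also have "\<dots> \<le> \<bar>KR\<bar> * sqrt s"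
      using nf by (intro mult_left_mono) auto
    finally have 1: "norm (R f) \<le> \<bar>KR\<bar> * sqrt s" .
    have "norm (L j f *\<^sub>R g j) \<le> \<bar>K j\<bar> * norm (g j)" if "j < n" for j
    proof -
      have "0 \<le> scaled_norm s f"
        using s by (simp add: scaled_norm_eq)
      then have "K j * scaled_norm s f \<le> \<bar>K j\<bar> * 1"
        using f(2) by (intro mult_mono) auto
      with K[OF that f(1)] have "\<bar>L j f\<bar> \<le> \<bar>K j\<bar>"
        by simp
      then show ?thesis
        by (simp add: mult_right_mono)
    qed
    then have "norm (A f) \<le> (\<Sum>j<n. \<bar>K j\<bar> * norm (g j))"
      unfolding A_eq by (intro sum_norm_le) auto
    with 1 show ?thesis
      using norm_triangle_ineq4[of "R f" "A f"] by linarith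
  qed
  then show ?thesis
    by (auto simp: bdd_above_def)
qed

lemma le_worst_case_error:
  assumes "s > 0" "continuous_linear_on V norm R"
    and "A \<in> linear_algorithms V (scaled_norm s) W n"
    and "f \<in> V" "scaled_norm s f \<le> 1"
  shows "norm (R f - A f) \<le> worst_case_error V (scaled_norm s) R A"
  unfolding worst_case_error_def
  by (rule cSUP_upper[OF _ bdd_above_algorithm_error]) (use assms in auto)

text \<open>Truncating the singular expansion to \<open>J\<close> attains error
  \<open>\<epsilon>\<close>. Fewer than \<open>card J\<close> functionals all vanish on some scaled
  unit vector in the span of the \<open>e j\<close>, and \<open>R\<close> maps that vector to one of
  norm above \<open>\<epsilon>\<close>, so no smaller number suffices.\<close>

theorem information_complexity_eq_card:
  fixes R :: "'h::real_inner \<Rightarrow> 'g::real_inner" and e :: "'j \<Rightarrow> 'h"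
  assumes V: "subspace V" and R: "continuous_linear_on V norm R" "R ` V \<subseteq> W"
    and s: "s > 0" and \<epsilon>: "\<epsilon> > 0" and J: "finite J"
    and eV: "\<And>j. j \<in> J \<Longrightarrow> e j \<in> V"
    and on: "\<And>i j. i \<in> J \<Longrightarrow> j \<in> J \<Longrightarrow> e i \<bullet> e j = (if i = j then 1 else 0)"
    and Re: "\<And>i j. i \<in> J \<Longrightarrow> j \<in> J \<Longrightarrow> i \<noteq> j \<Longrightarrow> R (e i) \<bullet> R (e j) = 0"
    and big: "\<And>j. j \<in> J \<Longrightarrow> \<epsilon>\<^sup>2 < s * (norm (R (e j)))\<^sup>2"
    and rest: "\<And>f. f \<in> V \<Longrightarrow>
      s * (norm (R f - (\<Sum>j\<in>J. (f \<bullet> e j) *\<^sub>R R (e j))))\<^sup>2 \<le> \<epsilon>\<^sup>2 * (norm f)\<^sup>2"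
  shows "information_complexity V (scaled_norm s) W R \<epsilon> = card J"
proof -
  let ?N = "scaled_norm s"
  have N_le: "?N f \<le> 1 \<longleftrightarrow> norm f \<le> sqrt s" for f :: 'h
    using s by (simp add: scaled_norm_eq)
  have ball0: "0 \<in> {f \<in> V. ?N f \<le> 1}"
    using V s by (simp add: N_le subspace_0)
  have wce_nonneg: "0 \<le> worst_case_error V ?N R A" if "A \<in> linear_algorithms V ?N W n" for A n
    using order_trans[OF norm_ge_zero le_worst_case_error[OF s R(1) that, of 0]] ball0 by simp
  have bdd: "bdd_below (worst_case_error V ?N R ` linear_algorithms V ?N W n)" for n
    using wce_nonneg by (auto simp: bdd_below_def)
  have upper: "minimal_error V ?N W R (card J) \<le> \<epsilon>"
  proof -
    obtain h where h: "bij_betw h {..<card J} J"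
      using ex_bij_betw_nat_finite[OF J] by (auto simp: atLeast0LessThan)
    define A where "A f = (\<Sum>k<card J. (f \<bullet> e (h k)) *\<^sub>R R (e (h k)))" for f
    have hJ: "h k \<in> J" if "k < card J" for k
      using bij_betwE[OF h] that by auto
    have "\<bar>f \<bullet> x\<bar> \<le> (norm x * sqrt s) * ?N f" for f x :: 'h
      using Cauchy_Schwarz_ineq2[of f x] s by (simp add: scaled_norm_eq mult.commute)
    then have L: "continuous_linear_on V ?N (\<lambda>f. f \<bullet> x)" for x :: 'h
      unfolding continuous_linear_on_def by (auto simp: inner_add_left)
    have A: "A \<in> linear_algorithms V ?N W (card J)"
      unfolding linear_algorithms_def
      using hJ eV R(2) L A_def
      by (intro CollectI exI[of _ "\<lambda>k f. f \<bullet> e (h k)"] exI[of _ "\<lambda>k. R (e (h k))"]) auto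
    have A_eq: "A f = (\<Sum>j\<in>J. (f \<bullet> e j) *\<^sub>R R (e j))" for f
      unfolding A_def by (rule sum.reindex_bij_betw[OF h])
    have "worst_case_error V ?N R A \<le> \<epsilon>"
      unfolding worst_case_error_def
    proof (rule cSUP_least)
      fix f assume f: "f \<in> {f \<in> V. ?N f \<le> 1}"
      then have "(norm f)\<^sup>2 \<le> (sqrt s)\<^sup>2"
        by (intro power_mono) (auto simp: N_le)
      then have "\<epsilon>\<^sup>2 * (norm f)\<^sup>2 \<le> \<epsilon>\<^sup>2 * s"
        using s by (intro mult_left_mono) auto
      with rest[of f] f have "s * (norm (R f - A f))\<^sup>2 \<le> s * \<epsilon>\<^sup>2"
        by (simp add: A_eq mult.commute)
      then have "(norm (R f - A f))\<^sup>2 \<le> \<epsilon>\<^sup>2"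
        using s by simp
      then show "norm (R f - A f) \<le> \<epsilon>"
        by (rule power2_le_imp_le) (use \<epsilon> in simp)
    qed (use ball0 in blast)
    then show ?thesis
      unfolding minimal_error_def by (rule cINF_lower2[OF bdd A])
  qed
  have lower: "\<epsilon> < minimal_error V ?N W R n" if n: "n < card J" for n
  proof -
    \<comment> \<open>A gap uniform in the algorithm is needed, since strict inequality for each
      algorithm alone could be lost in the infimum. Finiteness of \<open>J\<close> provides
      it.\<close>
    define \<beta> where "\<beta> = Min ((\<lambda>j. (norm (R (e j)))\<^sup>2) ` J)"
    have "J \<noteq> {}" using n by auto
    then have "\<beta> \<in> (\<lambda>j. (norm (R (e j)))\<^sup>2) ` J"
      unfolding \<beta>_def using J by (intro Min_in) auto
    then have "\<epsilon>\<^sup>2 < s * \<beta>"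
      using big by auto
    then have "\<epsilon> < sqrt (s * \<beta>)"
      by (rule real_less_rsqrt)
    also have "sqrt (s * \<beta>) \<le> minimal_error V ?N W R n"
      unfolding minimal_error_def
    proof (rule cINF_greatest)
      have "continuous_linear_on V ?N (\<lambda>f. 0 :: real)" "0 \<in> W"
        using R(2) continuous_linear_on_zero[OF R(1) V] subspace_0[OF V]
        by (auto simp: continuous_linear_on_def intro!: exI[of _ 0])
      then have "(\<lambda>f. \<Sum>j<n. 0 *\<^sub>R 0) \<in> linear_algorithms V ?N W n"
        unfolding linear_algorithms_def
        by (intro CollectI exI[of _ "\<lambda>_ _. 0"] exI[of _ "\<lambda>_. 0"]) auto
      then show "linear_algorithms V ?N W n \<noteq> {}"
        by auto
    next
      fix A assume A: "A \<in> linear_algorithms V ?N W n"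
      then obtain L g where L: "\<And>j. j < n \<Longrightarrow> continuous_linear_on V ?N (L j)"
        and A_eq: "A = (\<lambda>f. \<Sum>j<n. L j f *\<^sub>R g j)"
        unfolding linear_algorithms_def by auto
      obtain c where c: "\<exists>j\<in>J. c j \<noteq> 0" "\<And>k. k < n \<Longrightarrow> (\<Sum>j\<in>J. c j * L k (e j)) = 0"
        using underdetermined_homogeneous_system[OF J n, of "\<lambda>k j. L k (e j)"] by blast
      define \<gamma> where "\<gamma> = (\<Sum>j\<in>J. (c j)\<^sup>2)"
      have "\<gamma> > 0"
        unfolding \<gamma>_def using c(1) J by (auto intro!: sum_pos2)
      \<comment> \<open>The factor normalises \<open>f\<close> to \<open>norm f = sqrt s\<close>,
        the boundary of the scaled unit ball.\<close>
      define b where "b j = sqrt (s / \<gamma>) * c j" for j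
      define f where "f = (\<Sum>j\<in>J. b j *\<^sub>R e j)"
      have "(\<Sum>j\<in>J. (b j)\<^sup>2) = s / \<gamma> * \<gamma>"
        unfolding b_def \<gamma>_def[abs_def] sum_distrib_left
        using s \<open>\<gamma> > 0\<close> by (simp add: power_mult_distrib \<gamma>_def)
      then have b2: "(\<Sum>j\<in>J. (b j)\<^sup>2) = s"
        using \<open>\<gamma> > 0\<close> by simp
      have fV: "f \<in> V"
        unfolding f_def by (intro subspace_sum[OF V] subspace_scale[OF V] eV)
      have "(norm f)\<^sup>2 = (\<Sum>j\<in>J. (b j)\<^sup>2 * (norm (e j))\<^sup>2)"
        unfolding f_def using on by (intro norm_orthogonal_sum_scaleR[OF J]) auto
      also have "\<dots> = s"
        using on by (simp add: b2 power2_norm_eq_inner)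
      finally have "norm f = sqrt s"
        by (metis norm_ge_zero real_sqrt_unique)
      then have fN: "?N f \<le> 1"
        by (simp add: N_le)
      have "L k f = 0" if "k < n" for k
      proof -
        have "L k f = (\<Sum>j\<in>J. b j * L k (e j))"
          unfolding f_def using continuous_linear_on_sum[OF L[OF that] V eV] by simp
        also have "\<dots> = sqrt (s / \<gamma>) * (\<Sum>j\<in>J. c j * L k (e j))"
          by (simp add: b_def sum_distrib_left mult.assoc)
        finally show ?thesis using c(2)[OF that] by simp
      qed
      then have Af: "A f = 0"
        by (simp add: A_eq)
      have "R f = (\<Sum>j\<in>J. b j *\<^sub>R R (e j))"
        unfolding f_def by (rule continuous_linear_on_sum[OF R(1) V eV])
      then have "(norm (R f))\<^sup>2 = (\<Sum>j\<in>J. (b j)\<^sup>2 * (norm (R (e j)))\<^sup>2)"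
        using norm_orthogonal_sum_scaleR[OF J Re] by simp
      also have "\<dots> \<ge> (\<Sum>j\<in>J. (b j)\<^sup>2 * \<beta>)"
        unfolding \<beta>_def using J by (intro sum_mono mult_left_mono Min_le) auto
      also have "(\<Sum>j\<in>J. (b j)\<^sup>2 * \<beta>) = s * \<beta>"
        by (simp add: sum_distrib_right[symmetric] b2)
      finally have "sqrt (s * \<beta>) \<le> norm (R f)"
        by (simp add: real_le_lsqrt)
      also have "\<dots> \<le> worst_case_error V ?N R A"
        using le_worst_case_error[OF s R(1) A fV fN] Af by simp
      finally show "sqrt (s * \<beta>) \<le> worst_case_error V ?N R A" .
    qed
    finally show ?thesis .
  qed
  show ?thesis
    unfolding information_complexity_def
    using upper lower by (intro Least_equality) (auto simp: not_less[symmetric])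
qed

subsection \<open>Tensor powers\<close>

lemma subspace_closure_span:
  fixes A :: "'a::real_normed_vector set"
  shows "subspace (closure (span A))"
  unfolding subspace_def
proof (intro conjI ballI allI)
  show "0 \<in> closure (span A)"
    using closure_subset span_zero by blast
next
  fix x y assume "x \<in> closure (span A)" "y \<in> closure (span A)"
  then obtain X Y where "\<And>n. X n \<in> span A" "X \<longlonglongrightarrow> x" "\<And>n. Y n \<in> span A" "Y \<longlonglongrightarrow> y"
    unfolding closure_sequential by blast
  then show "x + y \<in> closure (span A)"
    unfolding closure_sequential
    by (intro exI[of _ "\<lambda>n. X n + Y n"]) (auto intro: span_add tendsto_add)
next
  fix c :: real and x assume "x \<in> closure (span A)"
  then obtain X where "\<And>n. X n \<in> span A" "X \<longlonglongrightarrow> x"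
    unfolding closure_sequential by blast
  then show "c *\<^sub>R x \<in> closure (span A)"
    unfolding closure_sequential
    by (intro exI[of _ "\<lambda>n. c *\<^sub>R X n"]) (auto intro: span_scale tendsto_scaleR)
qed

lemma bessel_inequality:
  fixes f :: "'a::real_inner"
  assumes J: "finite J"
    and on: "\<And>i j. i \<in> J \<Longrightarrow> j \<in> J \<Longrightarrow> e i \<bullet> e j = (if i = j then 1 else 0)"
  shows "(\<Sum>j\<in>J. (f \<bullet> e j)\<^sup>2) \<le> (norm f)\<^sup>2"
proof -
  define p where "p = (\<Sum>j\<in>J. (f \<bullet> e j) *\<^sub>R e j)"
  have "(norm p)\<^sup>2 = (\<Sum>j\<in>J. (f \<bullet> e j)\<^sup>2 * (norm (e j))\<^sup>2)"
    unfolding p_def by (rule norm_orthogonal_sum_scaleR[OF J]) (use on in auto)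
  also have "\<dots> = (\<Sum>j\<in>J. (f \<bullet> e j)\<^sup>2)"
    using on by (simp add: power2_norm_eq_inner)
  finally have pp: "p \<bullet> p = (\<Sum>j\<in>J. (f \<bullet> e j)\<^sup>2)"
    by (simp add: power2_norm_eq_inner)
  have fp: "f \<bullet> p = (\<Sum>j\<in>J. (f \<bullet> e j)\<^sup>2)"
    by (simp add: p_def inner_sum_right power2_eq_square)
  have "0 \<le> (f - p) \<bullet> (f - p)"
    by simp
  also have "\<dots> = f \<bullet> f - 2 * (f \<bullet> p) + p \<bullet> p"
    by (simp add: inner_diff inner_commute)
  finally show ?thesis
    using pp fp by (simp add: power2_norm_eq_inner)
qed

section \<open>Elementary tensors and singular values of tensor powers\<close>

lemma hilbert_tensor_power_inner:
  assumes "hilbert_tensor_power d T V"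
  shows "T x \<bullet> T y = (\<Prod>i<d. x i \<bullet> y i)"
  using assms by (simp add: hilbert_tensor_power_def)

text \<open>Both sides have the same inner product with every elementary tensor, and their
  difference is a combination of elementary tensors, hence orthogonal to itself.\<close>

lemma hilbert_tensor_power_expand:
  assumes T: "hilbert_tensor_power d T V" and A: "finite A"
  shows "T (\<lambda>i. \<Sum>m\<in>A. c i m *\<^sub>R v m) =
    (\<Sum>j\<in>{..<d} \<rightarrow>\<^sub>E A. (\<Prod>i<d. c i (j i)) *\<^sub>R T (\<lambda>i. v (j i)))" (is "?l = ?r")
proof -
  have eq: "?l \<bullet> T y = ?r \<bullet> T y" for y
  proof -
    have "?l \<bullet> T y = (\<Prod>i<d. \<Sum>m\<in>A. c i m * (v m \<bullet> y i))"
      by (simp add: hilbert_tensor_power_inner[OF T] inner_sum_left)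
    also have "\<dots> = (\<Sum>j\<in>{..<d} \<rightarrow>\<^sub>E A. \<Prod>i<d. c i (j i) * (v (j i) \<bullet> y i))"
      using A by (intro prod_sum_PiE) auto
    also have "\<dots> = ?r \<bullet> T y"
      by (simp add: hilbert_tensor_power_inner[OF T] inner_sum_left prod.distrib)
    finally show ?thesis .
  qed
  define z where "z = ?l - ?r"
  have "z \<bullet> T y = 0" for y
    using eq[of y] by (simp add: z_def inner_diff_left)
  then have "z \<bullet> (?l - ?r) = 0"
    by (simp add: inner_diff_right inner_sum_right)
  then have "z \<bullet> z = 0"
    unfolding z_def[symmetric] .
  then show ?thesis by (simp add: z_def)
qed

text \<open>The squared distance expands into products of inner products, which converge factor by
  factor.\<close>

lemma hilbert_tensor_power_tendsto:
  assumes T: "hilbert_tensor_power d T V"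
    and lim: "\<And>i. i < d \<Longrightarrow> (\<lambda>n. X n i) \<longlonglongrightarrow> x i"
  shows "(\<lambda>n. T (X n)) \<longlonglongrightarrow> T x"
proof -
  have eq: "(norm (T (X n) - T x))\<^sup>2 =
      (\<Prod>i<d. X n i \<bullet> X n i) - 2 * (\<Prod>i<d. X n i \<bullet> x i) + (\<Prod>i<d. x i \<bullet> x i)" for n
    unfolding power2_norm_eq_inner inner_diff_left inner_diff_right
      inner_commute[of "T x" "T (X n)"] hilbert_tensor_power_inner[OF T]
    by (simp add: inner_commute)
  have "(\<lambda>n. (norm (T (X n) - T x))\<^sup>2) \<longlonglongrightarrow>
      (\<Prod>i<d. x i \<bullet> x i) - 2 * (\<Prod>i<d. x i \<bullet> x i) + (\<Prod>i<d. x i \<bullet> x i)"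
    unfolding eq using lim by (intro tendsto_intros) auto
  then have "(\<lambda>n. (norm (T (X n) - T x))\<^sup>2) \<longlonglongrightarrow> 0"
    by simp
  from tendsto_real_sqrt[OF this] have "(\<lambda>n. norm (T (X n) - T x)) \<longlonglongrightarrow> 0"
    by simp
  then show ?thesis
    by (simp add: LIM_zero_iff tendsto_norm_zero_iff)
qed

text \<open>As \<open>lam\<close> tends to zero, a single large component of \<open>j\<close> pushes
  the product down to at most \<open>t\<close>; so all components stay below a common bound.\<close>

lemma finite_product_level_set:
  fixes lam :: "nat \<Rightarrow> real" and d :: nat
  assumes "decseq lam" "\<And>m. 0 \<le> lam m" "lam \<longlonglongrightarrow> 0" "0 < t"
  shows "finite {j \<in> {..<d} \<rightarrow>\<^sub>E UNIV. t < (\<Prod>i<d. lam (j i))}"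
proof -
  have le0: "lam m \<le> lam 0" for m
    using assms(1) by (simp add: decseq_def)
  \<comment> \<open>The base \<open>1 + lam 0\<close> is at least 1 and bounds every factor, so the
    remaining \<open>d - 1\<close> factors contribute at most
    \<open>(1 + lam 0) ^ d\<close>.\<close>
  define \<delta> where "\<delta> = t / (1 + lam 0) ^ d"
  have "\<delta> > 0"
    using assms(2)[of 0] assms(4) by (simp add: \<delta>_def)
  then have "eventually (\<lambda>m. lam m < \<delta>) sequentially"
    using assms(3) order_tendstoD(2) by blast
  then obtain N where N: "\<And>m. m \<ge> N \<Longrightarrow> lam m < \<delta>"
    by (auto simp: eventually_sequentially)
  have "j \<in> {..<d} \<rightarrow>\<^sub>E {..<N}" if j: "j \<in> {..<d} \<rightarrow>\<^sub>E UNIV" "t < (\<Prod>i<d. lam (j i))" for j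
  proof -
    have "j k < N" if "k < d" for k
    proof (rule ccontr)
      assume "\<not> j k < N"
      then have "lam (j k) < \<delta>"
        using N by simp
      have "(\<Prod>i<d. lam (j i)) = lam (j k) * (\<Prod>i\<in>{..<d} - {k}. lam (j i))"
        using that by (intro prod.remove) auto
      also have "\<dots> \<le> \<delta> * (\<Prod>i\<in>{..<d} - {k}. 1 + lam 0)"
        using \<open>lam (j k) < \<delta>\<close> \<open>\<delta> > 0\<close> assms(2) le0
        by (intro mult_mono prod_mono prod_nonneg) (auto intro: order_trans[OF le0])
      also have "\<dots> \<le> \<delta> * (1 + lam 0) ^ d"
        using \<open>\<delta> > 0\<close> assms(2)[of 0] that by (intro mult_left_mono) (auto intro: power_increasing)
      also have "\<dots> = t"
        using assms(2)[of 0] by (simp add: \<delta>_def)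
      finally show False using j(2) by simp
    qed
    then show ?thesis
      using j(1) by (auto simp: PiE_iff)
  qed
  then have "{j \<in> {..<d} \<rightarrow>\<^sub>E UNIV. t < (\<Prod>i<d. lam (j i))} \<subseteq> {..<d} \<rightarrow>\<^sub>E {..<N}"
    by blast
  then show ?thesis
    by (rule finite_subset) (simp add: finite_PiE)
qed

text \<open>Tensors of the singular vectors of \<open>S\<close> are singular vectors of
  \<open>R\<close>. That nothing else contributes is seen from finite partial sums
  \<open>Q M\<close>, which converge to \<open>R\<close> on elementary tensors. The estimate for
  terms outside \<open>J\<close> passes to the span in the limit and to \<open>V\<close> by
  density.\<close>

theorem information_complexity_tensor_power:
  fixes S :: "'a::{real_inner, complete_space} \<Rightarrow> 'b::{real_inner, complete_space}"
    and T :: "(nat \<Rightarrow> 'a) \<Rightarrow> 'h::real_inner" and T' :: "(nat \<Rightarrow> 'b) \<Rightarrow> 'g::real_inner"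
  assumes S: "compact_operator S" and lam: "eigenvalue_sequence (adjoint S \<circ> S) lam"
    and T: "hilbert_tensor_power d T V" and T': "hilbert_tensor_power d T' W"
    and R: "tensor_power_operator S T V T' W R"
    and s: "s > 0" and \<epsilon>: "\<epsilon> > 0"
  shows "information_complexity V (scaled_norm s) W R \<epsilon> =
    card {j \<in> {..<d} \<rightarrow>\<^sub>E UNIV. \<epsilon>\<^sup>2 / s < (\<Prod>i<d. lam (j i))}"
proof -
  obtain v where v: "\<And>m k. 0 < lam m \<Longrightarrow> 0 < lam k \<Longrightarrow> v m \<bullet> v k = (if m = k then 1 else 0)"
    and Sv: "\<And>m k. 0 < lam m \<Longrightarrow> 0 < lam k \<Longrightarrow> S (v m) \<bullet> S (v k) = (if m = k then lam m else 0)"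
    and tail: "\<And>M x. (norm (S x - (\<Sum>m | m < M \<and> 0 < lam m. (x \<bullet> v m) *\<^sub>R S (v m))))\<^sup>2
        \<le> lam M * (norm x)\<^sup>2"
    and lim0: "lam \<longlonglongrightarrow> 0"
    using compact_operator_singular_system[OF S lam] by blast
  have dec: "decseq lam" and nonneg: "\<And>m. 0 \<le> lam m"
    using lam by (auto simp: eigenvalue_sequence_def)
  define t where "t = \<epsilon>\<^sup>2 / s"
  have t: "t > 0" using s \<epsilon> by (simp add: t_def)
  define J where "J = {j \<in> {..<d} \<rightarrow>\<^sub>E UNIV. t < (\<Prod>i<d. lam (j i))}"
  have finJ: "finite J"
    unfolding J_def by (rule finite_product_level_set[OF dec nonneg lim0 t])
  \<comment> \<open>\<open>v\<close> is controlled only at positive eigenvalues, so orthonormality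
    is available on \<open>P\<close>; \<open>J\<close> lies in \<open>P\<close> because one zero
    factor annihilates the product.\<close>
  define P where "P = {..<d} \<rightarrow>\<^sub>E {m. 0 < lam m}"
  have JP: "J \<subseteq> P"
  proof
    fix j assume j: "j \<in> J"
    have "0 < lam (j i)" if "i < d" for i
    proof (rule ccontr)
      assume "\<not> 0 < lam (j i)"
      then have "lam (j i) = 0"
        using nonneg[of "j i"] by simp
      then have "(\<Prod>i<d. lam (j i)) = 0"
        using that by (intro prod_zero) auto
      moreover have "t < (\<Prod>i<d. lam (j i))"
        using j by (simp add: J_def)
      ultimately show False
        using t by linarith
    qed
    then show "j \<in> P"
      using j by (simp add: J_def P_def PiE_iff)
  qed
  define e where "e j = T (\<lambda>i. v (j i))" for j
  have V_eq: "V = closure (span (range T))"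
    using T by (simp add: hilbert_tensor_power_def)
  have V: "subspace V"
    unfolding V_eq by (rule subspace_closure_span)
  have TV: "T x \<in> V" for x
    unfolding V_eq by (rule subsetD[OF closure_subset]) (simp add: span_base)
  have Rcl: "continuous_linear_on V norm R" and RW: "R ` V \<subseteq> W"
    and RT: "\<And>x. R (T x) = T' (\<lambda>i. S (x i))"
    using R by (auto simp: tensor_power_operator_def)
  obtain K where K: "\<And>f. f \<in> V \<Longrightarrow> norm (R f) \<le> K * norm f"
    using Rcl unfolding continuous_linear_on_def by blast
  have R_add: "\<And>f g. f \<in> V \<Longrightarrow> g \<in> V \<Longrightarrow> R (f + g) = R f + R g"
    and R_scale: "\<And>c f. f \<in> V \<Longrightarrow> R (c *\<^sub>R f) = c *\<^sub>R R f"
    using Rcl unfolding continuous_linear_on_def by auto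
  have prod_delta: "(\<Prod>i<d. if j i = k i then a i else 0) = (if j = k then \<Prod>i<d. a i else 0)"
    if jk: "j \<in> P" "k \<in> P" for j k and a :: "nat \<Rightarrow> real"
  proof (cases "j = k")
    case False
    then obtain i where i: "i < d" "j i \<noteq> k i"
      using jk PiE_ext[of j "{..<d}" "\<lambda>_. {m. 0 < lam m}" k] unfolding P_def by auto
    have "(\<Prod>i<d. if j i = k i then a i else 0) = 0"
      by (rule prod_zero) (use i in auto)
    then show ?thesis
      using False by simp
  qed simp
  have Ppos: "0 < lam (j i)" if "j \<in> P" "i < d" for j i
    using that by (auto simp: P_def PiE_iff)
  have on: "e j \<bullet> e k = (if j = k then 1 else 0)" if "j \<in> P" "k \<in> P" for j k
  proof -
    have "e j \<bullet> e k = (\<Prod>i<d. if j i = k i then 1 else 0)"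
      using that Ppos v by (simp add: e_def hilbert_tensor_power_inner[OF T])
    then show ?thesis
      using prod_delta[OF that, of "\<lambda>_. 1"] by simp
  qed
  have Re: "R (e j) \<bullet> R (e k) = (if j = k then \<Prod>i<d. lam (j i) else 0)"
    if "j \<in> P" "k \<in> P" for j k
  proof -
    have "R (e j) \<bullet> R (e k) = (\<Prod>i<d. if j i = k i then lam (j i) else 0)"
      using that Ppos Sv by (simp add: e_def RT hilbert_tensor_power_inner[OF T'])
    then show ?thesis
      using prod_delta[OF that, of "\<lambda>i. lam (j i)"] by simp
  qed
  define F where "F M = {m. m < M \<and> 0 < lam m}" for M
  define Q where "Q M f = (\<Sum>j\<in>{..<d} \<rightarrow>\<^sub>E F M. (f \<bullet> e j) *\<^sub>R R (e j))" for M f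
  have finF: "finite (F M)" for M
    by (simp add: F_def)
  \<comment> \<open>On an elementary tensor, \<open>Q M\<close> is the tensor of the truncated
    expansions of the \<open>S (x i)\<close>, so convergence in each factor suffices.\<close>
  have Q_lim_elem: "(\<lambda>M. Q M (T x)) \<longlonglongrightarrow> R (T x)" for x
  proof -
    have "Q M (T x) = T' (\<lambda>i. \<Sum>m\<in>F M. (x i \<bullet> v m) *\<^sub>R S (v m))" for M
      using hilbert_tensor_power_expand[OF T' finF, of "\<lambda>i m. x i \<bullet> v m" "\<lambda>m. S (v m)" M]
      by (simp add: Q_def e_def RT hilbert_tensor_power_inner[OF T])
    moreover have "(\<lambda>M. T' (\<lambda>i. \<Sum>m\<in>F M. (x i \<bullet> v m) *\<^sub>R S (v m))) \<longlonglongrightarrow> T' (\<lambda>i. S (x i))"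
    proof (rule hilbert_tensor_power_tendsto[OF T'])
      fix i
      let ?p = "\<lambda>M. \<Sum>m\<in>F M. (x i \<bullet> v m) *\<^sub>R S (v m)"
      have l: "(\<lambda>M. lam M * (norm (x i))\<^sup>2) \<longlonglongrightarrow> 0"
        using tendsto_mult_right[OF lim0, of "(norm (x i))\<^sup>2"] by simp
      have "(\<lambda>M. (norm (S (x i) - ?p M))\<^sup>2) \<longlonglongrightarrow> 0"
        by (rule tendsto_sandwich[OF _ _ tendsto_const l]) (use tail in \<open>auto simp: F_def\<close>)
      from tendsto_real_sqrt[OF this] have "(\<lambda>M. S (x i) - ?p M) \<longlonglongrightarrow> 0"
        by (simp add: tendsto_norm_zero_iff)
      from tendsto_diff[OF tendsto_const[of "S (x i)"] this]
      show "?p \<longlonglongrightarrow> S (x i)" by simp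
    qed
    ultimately show ?thesis
      by (simp add: RT)
  qed
  have Q_lim: "(\<lambda>M. Q M f) \<longlonglongrightarrow> R f" if "f \<in> span (range T)" for f
  proof -
    have "f \<in> V \<and> (\<lambda>M. Q M f) \<longlonglongrightarrow> R f"
      using that
    proof (rule span_induct)
      have "Q M (f + g) = Q M f + Q M g" for M f g
        by (simp add: Q_def inner_add_left scaleR_add_left sum.distrib)
      moreover have "Q M (c *\<^sub>R f) = c *\<^sub>R Q M f" for M c f
        by (simp add: Q_def scaleR_sum_right)
      moreover have "Q M 0 = 0" for M
        by (simp add: Q_def)
      ultimately show "subspace {f. f \<in> V \<and> (\<lambda>M. Q M f) \<longlonglongrightarrow> R f}"
        using V continuous_linear_on_zero[OF Rcl V]
        by (auto simp: subspace_def R_add R_scale intro!: tendsto_add tendsto_scaleR)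
    qed (use TV Q_lim_elem in auto)
    then show ?thesis ..
  qed
  define A where "A f = (\<Sum>j\<in>J. (f \<bullet> e j) *\<^sub>R R (e j))" for f
  \<comment> \<open>The terms outside \<open>J\<close> have orthogonal images of squared norm at
    most \<open>t\<close>, and Bessel's inequality controls their coefficients.\<close>
  have Q_sub_A: "(norm (Q M f - A f))\<^sup>2 \<le> t * (norm f)\<^sup>2" if "J \<subseteq> {..<d} \<rightarrow>\<^sub>E F M" for M f
  proof -
    define D where "D = ({..<d} \<rightarrow>\<^sub>E F M) - J"
    have finPi: "finite ({..<d} \<rightarrow>\<^sub>E F M)"
      using finF by (simp add: finite_PiE)
    then have finD: "finite D" by (simp add: D_def)
    have DP: "D \<subseteq> P"
      by (auto simp: D_def P_def F_def PiE_iff)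
    have "Q M f - A f = (\<Sum>j\<in>D. (f \<bullet> e j) *\<^sub>R R (e j))"
      unfolding Q_def A_def D_def using that finPi by (subst sum_diff) auto
    moreover have "R (e i) \<bullet> R (e j) = 0" if "i \<in> D" "j \<in> D" "i \<noteq> j" for i j
      using Re[of i j] that DP by auto
    ultimately have "(norm (Q M f - A f))\<^sup>2 = (\<Sum>j\<in>D. (f \<bullet> e j)\<^sup>2 * (norm (R (e j)))\<^sup>2)"
      by (simp only:) (rule norm_orthogonal_sum_scaleR[OF finD])
    also have "\<dots> \<le> (\<Sum>j\<in>D. (f \<bullet> e j)\<^sup>2 * t)"
    proof (intro sum_mono mult_left_mono)
      fix j assume j: "j \<in> D"
      then have "\<not> t < (\<Prod>i<d. lam (j i))"
        by (auto simp: D_def J_def PiE_iff)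
      then show "(norm (R (e j)))\<^sup>2 \<le> t"
        using Re[of j j] j DP by (auto simp: power2_norm_eq_inner)
    qed simp
    also have "\<dots> = t * (\<Sum>j\<in>D. (f \<bullet> e j)\<^sup>2)"
      by (simp add: sum_distrib_left mult.commute)
    also have "\<dots> \<le> t * (norm f)\<^sup>2"
    proof (rule mult_left_mono[OF bessel_inequality[OF finD]])
      show "e i \<bullet> e j = (if i = j then 1 else 0)" if "i \<in> D" "j \<in> D" for i j
        using on that DP by blast
    qed (use t in simp)
    finally show ?thesis .
  qed
  \<comment> \<open>From \<open>M = N\<close> on, the partial sum \<open>Q M\<close> contains every
    term of the finite set \<open>J\<close>.\<close>
  obtain N where N: "\<And>j i. j \<in> J \<Longrightarrow> i < d \<Longrightarrow> j i < N"
  proof -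
    have "finite (\<Union>j\<in>J. j ` {..<d})"
      using finJ by simp
    then obtain N where "(\<Union>j\<in>J. j ` {..<d}) \<subseteq> {..<N}"
      using finite_nat_bounded by blast
    then show ?thesis by (intro that[of N]) auto
  qed
  have J_sub: "J \<subseteq> {..<d} \<rightarrow>\<^sub>E F M" if "M \<ge> N" for M
  proof
    fix j assume "j \<in> J"
    then show "j \<in> {..<d} \<rightarrow>\<^sub>E F M"
      using N[of j] JP that Ppos[of j] by (force simp: PiE_iff F_def P_def)
  qed
  have rest_span: "(norm (R f - A f))\<^sup>2 \<le> t * (norm f)\<^sup>2" if "f \<in> span (range T)" for f
  proof (rule LIMSEQ_le_const2)
    show "(\<lambda>M. (norm (Q M f - A f))\<^sup>2) \<longlonglongrightarrow> (norm (R f - A f))\<^sup>2"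
      by (intro tendsto_intros Q_lim that)
    show "\<exists>N. \<forall>M\<ge>N. (norm (Q M f - A f))\<^sup>2 \<le> t * (norm f)\<^sup>2"
      using Q_sub_A J_sub by blast
  qed
  have rest: "(norm (R f - A f))\<^sup>2 \<le> t * (norm f)\<^sup>2" if f: "f \<in> V" for f
  proof -
    obtain X where X: "\<And>n. X n \<in> span (range T)" "X \<longlonglongrightarrow> f"
      using f unfolding V_eq closure_sequential by blast
    have XV: "X n \<in> V" for n
      using X(1) closure_subset unfolding V_eq by blast
    have "(\<lambda>n. R (X n)) \<longlonglongrightarrow> R f"
    proof -
      have "norm (R (X n) - R f) \<le> K * norm (X n - f)" for n
      proof -
        have "X n - f \<in> V"
          using V XV f by (simp add: subspace_diff)
        moreover from this have "R (X n) = R (X n - f) + R f"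
          using R_add[of "X n - f" f] f by simp
        ultimately show ?thesis
          using K[of "X n - f"] by simp
      qed
      moreover have l: "(\<lambda>n. K * norm (X n - f)) \<longlonglongrightarrow> 0"
        using tendsto_mult_left[OF tendsto_norm[OF tendsto_diff[OF X(2) tendsto_const[of f]]], of K]
        by simp
      ultimately have "(\<lambda>n. norm (R (X n) - R f)) \<longlonglongrightarrow> 0"
        by (intro tendsto_sandwich[OF _ _ tendsto_const l]) auto
      then show ?thesis
        by (simp add: LIM_zero_iff tendsto_norm_zero_iff)
    qed
    moreover have "(\<lambda>n. A (X n)) \<longlonglongrightarrow> A f"
      unfolding A_def by (intro tendsto_intros X(2))
    ultimately have 1: "(\<lambda>n. (norm (R (X n) - A (X n)))\<^sup>2) \<longlonglongrightarrow> (norm (R f - A f))\<^sup>2"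
      by (intro tendsto_intros)
    have 2: "(\<lambda>n. t * (norm (X n))\<^sup>2) \<longlonglongrightarrow> t * (norm f)\<^sup>2"
      by (intro tendsto_intros X(2))
    show ?thesis
      by (rule LIMSEQ_le[OF 1 2]) (use rest_span X(1) in blast)
  qed
  have "information_complexity V (scaled_norm s) W R \<epsilon> = card J"
  proof (rule information_complexity_eq_card[OF V Rcl RW s \<epsilon> finJ])
    show "e j \<in> V" for j by (simp add: e_def TV)
    show "e i \<bullet> e j = (if i = j then 1 else 0)" if "i \<in> J" "j \<in> J" for i j
      using on that JP by blast
    show "R (e i) \<bullet> R (e j) = 0" if "i \<in> J" "j \<in> J" "i \<noteq> j" for i j
      using Re[of i j] that JP by auto
    show "\<epsilon>\<^sup>2 < s * (norm (R (e j)))\<^sup>2" if "j \<in> J" for j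
    proof -
      have "j \<in> P"
        using that JP by blast
      then have "(norm (R (e j)))\<^sup>2 = (\<Prod>i<d. lam (j i))"
        using Re[of j j] by (simp add: power2_norm_eq_inner)
      also have "t < \<dots>"
        using that by (simp add: J_def)
      finally show ?thesis
        using s by (simp add: t_def field_simps)
    qed
    show "s * (norm (R f - (\<Sum>j\<in>J. (f \<bullet> e j) *\<^sub>R R (e j))))\<^sup>2 \<le> \<epsilon>\<^sup>2 * (norm f)\<^sup>2"
      if "f \<in> V" for f
      using rest[OF that] s by (simp add: t_def A_def field_simps)
  qed
  then show ?thesis
    by (simp add: J_def t_def)
qed

subsection \<open>Tractability in terms of the eigenvalues\<close>

text \<open>Dyadic decomposition of the values below \<open>1\<close>: the level counts are used for \<open>\<epsilon>\<^sup>2 = 2\<^bsup>-k-1\<^esup>\<close>.\<close>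
lemma sum_powr_le_of_level_counts:
  fixes a :: "'j \<Rightarrow> real"
  assumes F: "finite F" and a: "\<And>j. j \<in> F \<Longrightarrow> 0 \<le> a j" "\<And>j. j \<in> F \<Longrightarrow> a j \<le> B"
    and count: "\<And>\<epsilon>. 0 < \<epsilon> \<Longrightarrow> \<epsilon> \<le> 1 \<Longrightarrow> real (card {j \<in> F. \<epsilon>\<^sup>2 < a j}) \<le> D * \<epsilon> powr (-p)"
    and p: "0 < p" "p / 2 < \<tau>"
  shows "(\<Sum>j\<in>F. a j powr \<tau>) \<le> D * (B powr \<tau> + 2 powr (p / 2) / (1 - 2 powr (p / 2 - \<tau>)))"
proof -
  have \<tau>: "\<tau> > 0" using p by simp
  \<comment> \<open>The ratio of the geometric series over the dyadic levels, below 1 because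
    \<open>p / 2 < \<tau>\<close>.\<close>
  define w :: real where "w = 2 powr (p / 2 - \<tau>)"
  have w: "0 < w" "w < 1"
    using p by (auto simp: w_def powr_less_one)
  have D: "0 \<le> D"
    using count[of 1] by simp
  have "\<exists>K. \<forall>j\<in>F. 0 < a j \<longrightarrow> (1/2) ^ K < a j"
  proof -
    have "eventually (\<lambda>K. 0 < a j \<longrightarrow> (1/2) ^ K < a j) sequentially" for j
      using order_tendstoD(2)[OF LIMSEQ_realpow_zero[of "1/2"], of "a j"]
      by (cases "0 < a j") (auto elim: eventually_mono)
    then have "eventually (\<lambda>K. \<forall>j\<in>F. 0 < a j \<longrightarrow> (1/2) ^ K < a j) sequentially"
      using F by (intro eventually_ball_finite) auto
    then show ?thesis
      using eventually_happens'[OF sequentially_bot] by blast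
  qed
  then obtain K where K: "\<And>j. j \<in> F \<Longrightarrow> 0 < a j \<Longrightarrow> (1/2) ^ K < a j"
    by blast
  \<comment> \<open>A value above 1 is bounded by \<open>B\<close>, a value between
    \<open>(1/2) ^ Suc k\<close> and \<open>(1/2) ^ k\<close> by its upper end. The first
    \<open>K\<close> levels reach all positive values of the finite family.\<close>
  have pointwise: "a j powr \<tau> \<le> B powr \<tau> * of_bool (1 < a j) +
      (\<Sum>k<K. ((1/2) ^ k) powr \<tau> * of_bool ((1/2) ^ Suc k < a j))" (is "_ \<le> ?b + ?s")
    if j: "j \<in> F" for j
  proof -
    have s0: "0 \<le> ?s" and b0: "0 \<le> ?b"
      by (auto intro: sum_nonneg)
    consider "a j = 0" | "1 < a j" | "0 < a j" "a j \<le> 1"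
      using a(1)[OF j] by linarith
    then show ?thesis
    proof cases
      case 1
      then show ?thesis using s0 b0 by simp
    next
      case 2
      then have "a j powr \<tau> \<le> B powr \<tau>"
        using a[OF j] \<tau> by (intro powr_mono2) auto
      then show ?thesis using 2 s0 by simp
    next
      case 3
      define k where "k = (LEAST k. (1/2) ^ Suc k < a j)"
      have "K \<noteq> 0"
        using K[OF j 3(1)] 3(2) by (intro notI) simp
      then have K1: "(1/2) ^ Suc (K - 1) < a j"
        using K[OF j 3(1)] by simp
      then have k1: "(1/2) ^ Suc k < a j"
        unfolding k_def by (rule LeastI)
      have "k \<le> K - 1"
        unfolding k_def using K1 by (rule Least_le)
      then have "k < K" using \<open>K \<noteq> 0\<close> by simp
      have "a j \<le> (1/2) ^ k"
      proof (cases k)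
        case (Suc k')
        then have "\<not> (1/2) ^ Suc k' < a j"
          using not_less_Least[of k' "\<lambda>k. (1/2) ^ Suc k < a j"] by (simp add: k_def)
        then show ?thesis using Suc by simp
      qed (use 3 in simp)
      then have "a j powr \<tau> \<le> ((1/2) ^ k) powr \<tau> * of_bool ((1/2) ^ Suc k < a j)"
        using k1 3(1) \<tau> by (auto intro: powr_mono2)
      also have "\<dots> \<le> ?s"
        using \<open>k < K\<close> by (intro member_le_sum) auto
      finally show ?thesis using b0 by linarith
    qed
  qed
  have card_eq: "(\<Sum>j\<in>F. of_bool (c < a j)) = real (card {j \<in> F. c < a j})" for c
    using F by (simp add: sum.If_cases of_bool_def Int_def)
  have half: "(1 / 2) ^ n = (2::real) powr (- real n)" for n
    by (simp add: powr_minus powr_realpow power_one_over inverse_eq_divide)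
  have level: "((1/2) ^ k) powr \<tau> * real (card {j \<in> F. (1/2) ^ Suc k < a j}) \<le> D * 2 powr (p / 2) * w ^ k" for k
  proof -
    define \<epsilon> :: real where "\<epsilon> = 2 powr (- real (Suc k) / 2)"
    have "\<epsilon>\<^sup>2 = 2 powr (- real (Suc k) / 2 + - real (Suc k) / 2)"
      unfolding \<epsilon>_def power2_eq_square by (rule powr_add[symmetric])
    also have "\<dots> = (1/2) ^ Suc k"
      by (simp only: half field_sum_of_halves)
    finally have \<epsilon>2: "\<epsilon>\<^sup>2 = (1/2) ^ Suc k" .
    have "0 < \<epsilon>" "\<epsilon> \<le> 1"
      using powr_mono[of "- real (Suc k) / 2" 0 2] by (auto simp: \<epsilon>_def)
    then have "real (card {j \<in> F. (1/2) ^ Suc k < a j}) \<le> D * \<epsilon> powr (-p)"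
      using count[of \<epsilon>] unfolding \<epsilon>2 by blast
    then have "((1/2) ^ k) powr \<tau> * real (card {j \<in> F. (1/2) ^ Suc k < a j}) \<le>
        ((1/2) ^ k) powr \<tau> * (D * \<epsilon> powr (-p))"
      by (intro mult_left_mono) auto
    also have "\<dots> = D * 2 powr (p / 2) * w ^ k"
    proof -
      have e1: "((1/2) ^ k) powr \<tau> = 2 powr (- (real k * \<tau>))"
        by (simp add: half powr_powr)
      have e2: "\<epsilon> powr (-p) = 2 powr (p / 2 + real k * (p / 2))"
        by (simp add: \<epsilon>_def powr_powr field_simps)
      have e3: "w ^ k = 2 powr (real k * (p / 2) - real k * \<tau>)"
        by (simp add: w_def powr_powr algebra_simps flip: powr_realpow)
      have "inverse x * (D * (y * z)) = D * y * (z / x)" for x y z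
        by (simp add: divide_inverse)
      then show ?thesis
        unfolding e1 e2 e3 unfolding powr_add powr_diff powr_minus .
    qed
    finally show ?thesis .
  qed
  have geometric: "(\<Sum>k<K. D * 2 powr (p / 2) * w ^ k) \<le> D * 2 powr (p / 2) * (1 / (1 - w))"
  proof -
    have "(\<Sum>k<K. w ^ k) \<le> (\<Sum>k. w ^ k)"
      using w by (intro sum_le_suminf) auto
    also have "\<dots> = 1 / (1 - w)"
      using w by (simp add: suminf_geometric)
    finally show ?thesis
      unfolding sum_distrib_left[symmetric] using D by (intro mult_left_mono) auto
  qed
  have "(\<Sum>j\<in>F. a j powr \<tau>) \<le> (\<Sum>j\<in>F. B powr \<tau> * of_bool (1 < a j) +
      (\<Sum>k<K. ((1/2) ^ k) powr \<tau> * of_bool ((1/2) ^ Suc k < a j)))"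
    by (intro sum_mono pointwise)
  also have "\<dots> = B powr \<tau> * (\<Sum>j\<in>F. of_bool (1 < a j)) +
      (\<Sum>k<K. ((1/2) ^ k) powr \<tau> * (\<Sum>j\<in>F. of_bool ((1/2) ^ Suc k < a j)))"
    unfolding sum.distrib sum_distrib_left by (subst (2) sum.swap) simp
  also have "\<dots> = B powr \<tau> * real (card {j \<in> F. 1 < a j}) +
      (\<Sum>k<K. ((1/2) ^ k) powr \<tau> * real (card {j \<in> F. (1/2) ^ Suc k < a j}))"
    by (simp only: card_eq)
  also have "\<dots> \<le> B powr \<tau> * D + (\<Sum>k<K. D * 2 powr (p / 2) * w ^ k)"
    using count[of 1] by (intro add_mono mult_left_mono sum_mono level) auto
  also have "\<dots> \<le> B powr \<tau> * D + D * 2 powr (p / 2) * (1 / (1 - w))"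
    using geometric by simp
  finally show ?thesis
    by (simp add: w_def algebra_simps)
qed

section \<open>Conditions (III) and (IV) for an eigenvalue sequence\<close>

lemma ell_scaling_condition_iff:
  "ell_scaling_condition s lam \<tau> \<longleftrightarrow>
    0 < \<tau> \<and> in_ell \<tau> lam \<and> (\<exists>K. \<forall>d\<ge>1. s d * ell_norm \<tau> lam ^ d \<le> K)"
proof -
  have "(SUP d\<in>{1..}. ereal (s d * ell_norm \<tau> lam ^ d)) < \<infinity> \<longleftrightarrow>
      (\<exists>K. \<forall>d\<ge>1. s d * ell_norm \<tau> lam ^ d \<le> K)" (is "?L \<longleftrightarrow> ?R")
  proof
    assume ?L
    then obtain n :: nat where "(SUP d\<in>{1..}. ereal (s d * ell_norm \<tau> lam ^ d)) < ereal (real n)"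
      using less_PInf_Ex_of_nat by auto
    from SUP_lessD[OF this] have "s d * ell_norm \<tau> lam ^ d \<le> real n" if "d \<ge> 1" for d
      using that by (simp add: less_imp_le)
    then show ?R by blast
  next
    assume ?R
    then obtain K where "\<And>d. d \<ge> 1 \<Longrightarrow> s d * ell_norm \<tau> lam ^ d \<le> K" by blast
    then have "(SUP d\<in>{1..}. ereal (s d * ell_norm \<tau> lam ^ d)) \<le> ereal K"
      by (intro SUP_least) auto
    then show ?L
      by (rule le_less_trans) simp
  qed
  then show ?thesis
    by (simp add: ell_scaling_condition_def)
qed

text \<open>The operators enter only through the counting formula for \<open>N\<close>; everything
  in the locale concerns real sequences. Index tuples are extensional functions, so each tuple of
  length \<open>d\<close> is counted once.\<close>

locale scaled_spectrum =
  fixes lam :: "nat \<Rightarrow> real" and s :: "nat \<Rightarrow> real" and N :: "real \<Rightarrow> nat \<Rightarrow> nat"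
  assumes dec: "decseq lam" and nonneg: "\<And>m. 0 \<le> lam m" and lam1: "0 < lam 1"
    and s_pos: "\<And>d. d \<ge> 1 \<Longrightarrow> 0 < s d"
    and finite_level: "\<And>t (d::nat). 0 < t \<Longrightarrow> finite {j \<in> {..<d} \<rightarrow>\<^sub>E UNIV. t < (\<Prod>i<d. lam (j i))}"
    and N: "\<And>\<epsilon> d. 0 < \<epsilon> \<Longrightarrow> \<epsilon> \<le> 1 \<Longrightarrow> d \<ge> 1 \<Longrightarrow>
      N \<epsilon> d = card {j \<in> {..<d} \<rightarrow>\<^sub>E UNIV. \<epsilon>\<^sup>2 / s d < (\<Prod>i<d. lam (j i))}"
begin

lemma le_lam0: "lam m \<le> lam 0"
  using dec by (simp add: decseq_def)

lemma lam0: "0 < lam 0"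
  using lam1 le_lam0[of 1] by simp

lemma ell_powr:
  assumes "0 < \<tau>" "in_ell \<tau> lam"
  shows "ell_norm \<tau> lam powr \<tau> = (\<Sum>m. lam m powr \<tau>)"
  using assms by (simp add: ell_norm_def powr_powr in_ell_def suminf_nonneg)

text \<open>Two positive terms of the series already exceed the first one. This is the source of the
  strict inequality in (IV).\<close>

lemma lam0_less_ell_norm:
  assumes "0 < \<tau>" "in_ell \<tau> lam"
  shows "lam 0 < ell_norm \<tau> lam"
proof -
  have "lam 0 powr \<tau> < (\<Sum>m<2. lam m powr \<tau>)"
    using lam1 by (simp add: numeral_2_eq_2)
  also have "\<dots> \<le> (\<Sum>m. lam m powr \<tau>)"
    using assms by (intro sum_le_suminf) (auto simp: in_ell_def)
  finally have "lam 0 powr \<tau> < ell_norm \<tau> lam powr \<tau>"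
    using ell_powr[OF assms] by simp
  then show ?thesis
    using assms(1) lam0 by (metis ell_norm_def linorder_not_le powr_ge_zero powr_mono2 less_imp_le)
qed

text \<open>Markov's inequality for the powers with exponent \<open>\<tau>\<close>, whose sum over
  all tuples factorises into a \<open>d\<close>-th power. The constant is
  \<open>K powr \<tau>\<close> with \<open>K\<close> the bound from (III).\<close>

lemma complexity_bound_of_ell_scaling:
  assumes "ell_scaling_condition s lam \<tau>"
  shows "\<exists>C>0. complexity_bound N C (2 * \<tau>) 0"
proof -
  obtain K where \<tau>: "0 < \<tau>" and ell: "in_ell \<tau> lam"
    and K: "\<And>d. d \<ge> 1 \<Longrightarrow> s d * ell_norm \<tau> lam ^ d \<le> K"
    using assms unfolding ell_scaling_condition_iff by blast
  have ellpos: "0 < ell_norm \<tau> lam"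
    using lam0_less_ell_norm[OF \<tau> ell] lam0 by simp
  have "0 < s 1 * ell_norm \<tau> lam ^ 1"
    using ellpos s_pos[of 1] by simp
  then have "K > 0" using K[of 1] by simp
  have "real (N \<epsilon> d) \<le> K powr \<tau> * \<epsilon> powr (- (2 * \<tau>)) * real d powr 0"
    if \<epsilon>: "0 < \<epsilon>" "\<epsilon> \<le> 1" and d: "d \<ge> 1" for \<epsilon> d
  proof -
    define t where "t = \<epsilon>\<^sup>2 / s d"
    have t: "t > 0" using \<epsilon> s_pos[OF d] by (simp add: t_def)
    define J where "J = {j \<in> {..<d} \<rightarrow>\<^sub>E UNIV. t < (\<Prod>i<d. lam (j i))}"
    have finJ: "finite J"
      unfolding J_def by (rule finite_level[OF t])
    then have "finite (\<Union>j\<in>J. j ` {..<d})" by simp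
    \<comment> \<open>Enclosing \<open>J\<close> in a finite box lets the sum of products factorise
      without infinite sums over tuples.\<close>
    then obtain M where M: "(\<Union>j\<in>J. j ` {..<d}) \<subseteq> {..<M}"
      using finite_nat_bounded by blast
    have "j i < M" if "j \<in> J" "i < d" for j i
      using M that by blast
    moreover have "J \<subseteq> {..<d} \<rightarrow>\<^sub>E UNIV"
      by (auto simp: J_def)
    ultimately have J_sub: "J \<subseteq> {..<d} \<rightarrow>\<^sub>E {..<M}"
      by (auto simp: PiE_iff subset_iff)
    have "real (card J) * t powr \<tau> = (\<Sum>j\<in>J. t powr \<tau>)"
      by simp
    also have "\<dots> \<le> (\<Sum>j\<in>J. (\<Prod>i<d. lam (j i)) powr \<tau>)"
      using t \<tau> by (intro sum_mono powr_mono2) (auto simp: J_def)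
    also have "\<dots> \<le> (\<Sum>j\<in>{..<d} \<rightarrow>\<^sub>E {..<M}. (\<Prod>i<d. lam (j i)) powr \<tau>)"
      using J_sub by (intro sum_mono2) (auto simp: finite_PiE)
    also have "\<dots> = (\<Prod>i<d. \<Sum>m<M. lam m powr \<tau>)"
      by (subst prod_sum_PiE) (auto simp: prod_powr_distrib)
    also have "\<dots> \<le> (\<Prod>i<d. ell_norm \<tau> lam powr \<tau>)"
      unfolding ell_powr[OF \<tau> ell] using ell
      by (intro prod_mono conjI sum_nonneg sum_le_suminf) (auto simp: in_ell_def)
    also have "\<dots> = (ell_norm \<tau> lam ^ d) powr \<tau>"
      using ellpos by (simp add: powr_power powr_powr mult.commute flip: powr_realpow)
    finally have "real (card J) \<le> (ell_norm \<tau> lam ^ d) powr \<tau> / t powr \<tau>"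
      using t by (simp add: field_simps)
    also have "\<dots> = (s d * ell_norm \<tau> lam ^ d) powr \<tau> * \<epsilon> powr (- (2 * \<tau>))"
    proof -
      have "(ell_norm \<tau> lam ^ d) powr \<tau> / t powr \<tau> = (s d * ell_norm \<tau> lam ^ d / \<epsilon>\<^sup>2) powr \<tau>"
        using \<epsilon> s_pos[OF d] ellpos by (simp add: t_def powr_divide[symmetric] mult.commute)
      also have "\<dots> = (s d * ell_norm \<tau> lam ^ d) powr \<tau> / \<epsilon>\<^sup>2 powr \<tau>"
        using \<epsilon> s_pos[OF d] ellpos by (simp add: powr_divide)
      also have "\<epsilon>\<^sup>2 powr \<tau> = \<epsilon> powr (2 * \<tau>)"
        using \<epsilon> by (simp add: powr_powr flip: powr_numeral)
      finally show ?thesis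
        by (simp add: powr_minus divide_inverse)
    qed
    also have "\<dots> \<le> K powr \<tau> * \<epsilon> powr (- (2 * \<tau>))"
      using K[OF d] s_pos[OF d] ellpos \<tau> by (intro mult_right_mono powr_mono2) auto
    finally show ?thesis
      using N[OF \<epsilon> d] d by (simp add: J_def t_def)
  qed
  then show ?thesis
    using \<open>K > 0\<close> unfolding complexity_bound_def
    by (intro exI[of _ "K powr \<tau>"]) auto
qed

text \<open>The \<open>d choose k\<close> products with \<open>k\<close> factors \<open>lam 1\<close> and \<open>d - k\<close> factors \<open>lam 0\<close> cannot
  all exceed \<open>1 / s d\<close> for large \<open>d\<close> if \<open>k > q\<close>.\<close>
lemma largest_eigenvalue_bounded:
  assumes "complexity_bound N C p q" "0 < C" "0 \<le> q"
  shows "\<exists>B. \<forall>d\<ge>1. s d * lam 0 ^ d \<le> B"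
proof -
  \<comment> \<open>With \<open>q \<le> k - 1\<close>, the binomial coefficient
    \<open>d choose k\<close>, at least \<open>(d / k) ^ k\<close>, outgrows
    \<open>C * d powr q\<close>. Exchanging \<open>k\<close> factors \<open>lam 0\<close> for
    \<open>lam 1\<close> divides the product by \<open>r\<close>.\<close>
  define k where "k = nat \<lceil>q\<rceil> + 1"
  define r where "r = (lam 0 / lam 1) ^ k"
  have k: "k \<ge> 1" "q \<le> real (k - 1)"
    using assms(3) by (auto simp: k_def)
  obtain d0 :: nat where d0: "C * real k ^ k < real d0" "k \<le> d0"
  proof -
    obtain n :: nat where "C * real k ^ k < real n"
      using reals_Archimedean2 by blast
    then show ?thesis
      by (intro that[of "max n k"]) auto
  qed
  have large: "s d * lam 0 ^ d \<le> r" if "d \<ge> d0" for d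
  proof (rule ccontr)
    assume contra: "\<not> s d * lam 0 ^ d \<le> r"
    have d: "d \<ge> 1" "k \<le> d" using that d0 k by auto
    define j where "j X = (\<lambda>i\<in>{..<d}. if i \<in> X then 1 else 0 :: nat)" for X
    define J where "J = {j \<in> {..<d} \<rightarrow>\<^sub>E UNIV. 1\<^sup>2 / s d < (\<Prod>i<d. lam (j i))}"
    have "inj_on j {X. X \<subseteq> {..<d} \<and> card X = k}"
    proof (rule inj_onI)
      fix X Y assume X: "X \<in> {X. X \<subseteq> {..<d} \<and> card X = k}" and Y: "Y \<in> {X. X \<subseteq> {..<d} \<and> card X = k}"
        and eq: "j X = j Y"
      have "i \<in> X \<longleftrightarrow> i \<in> Y" if "i < d" for i
        using fun_cong[OF eq, of i] that by (auto simp: j_def split: if_splits)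
      then show "X = Y" using X Y by auto
    qed
    moreover have "j ` {X. X \<subseteq> {..<d} \<and> card X = k} \<subseteq> J"
    proof (intro subsetI, elim imageE CollectE conjE)
      fix f X assume X: "f = j X" "X \<subseteq> {..<d}" "card X = k"
      have "(\<Prod>i<d. lam (j X i)) = (\<Prod>i<d. if i \<in> X then lam 1 else lam 0)"
        by (intro prod.cong) (auto simp: j_def)
      also have "\<dots> = (\<Prod>i\<in>X. lam 1) * (\<Prod>i\<in>{..<d} - X. lam 0)"
        using X(2) by (subst prod.If_cases) (auto simp: Int_absorb1 Diff_eq)
      also have "\<dots> = lam 1 ^ k * lam 0 ^ (d - k)"
        using X(2,3) by (simp add: card_Diff_subset finite_subset[OF X(2)])
      also have "\<dots> = lam 0 ^ d / r"
        using lam0 lam1 d(2) by (simp add: r_def power_divide power_diff field_simps)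
      finally have eq: "(\<Prod>i<d. lam (j X i)) = lam 0 ^ d / r" .
      have "r > 0" using lam0 lam1 by (simp add: r_def)
      have "1\<^sup>2 / s d < lam 0 ^ d / r"
        using contra s_pos[OF d(1)] \<open>r > 0\<close> by (simp add: field_simps)
      then show "f \<in> J"
        using eq X(1) by (simp add: J_def) (simp add: j_def)
    qed
    moreover have "finite J"
      unfolding J_def using s_pos[OF d(1)] by (intro finite_level) simp
    ultimately have "card {X. X \<subseteq> {..<d} \<and> card X = k} \<le> card J"
      by (rule card_inj_on_le)
    then have "d choose k \<le> N 1 d"
      using n_subsets[of "{..<d}" k] N[of 1 d] d by (simp add: J_def)
    then have "real (d choose k) \<le> real (N 1 d)" by simp
    \<comment> \<open>Only \<open>\<epsilon> = 1\<close> is used here, so the power of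
      \<open>\<epsilon>\<close> disappears.\<close>
    also have "\<dots> \<le> C * real d powr q"
      using assms(1)[unfolded complexity_bound_def, THEN bspec[of _ _ 1], THEN spec[of _ d]] d(1)
      by simp
    also have "\<dots> \<le> C * real d powr real (k - 1)"
      using k d(1) assms(2) by (intro mult_left_mono powr_mono) auto
    also have "\<dots> = C * real d ^ (k - 1)"
      using d(1) by (simp add: powr_realpow)
    finally have "(real d / real k) ^ k \<le> C * real d ^ (k - 1)"
      using binomial_ge_n_over_k_pow_k[of k d, where 'a = real] d(2) by linarith
    then have "real d ^ k \<le> C * real k ^ k * real d ^ (k - 1)"
      using k(1) by (simp add: power_divide field_simps)
    moreover have "real d ^ k = real d * real d ^ (k - 1)"
      using k(1) by (simp flip: power_Suc)
    ultimately have "real d \<le> C * real k ^ k"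
      using d(1) by simp
    then show False using d0 that by linarith
  qed
  \<comment> \<open>The finitely many \<open>d < d0\<close> are absorbed by their sum; absolute
    values cover \<open>d = 0\<close>, where the sign of \<open>s d\<close> is unknown.\<close>
  define B where "B = r + (\<Sum>d<d0. \<bar>s d * lam 0 ^ d\<bar>)"
  have "r > 0" using lam0 lam1 by (simp add: r_def)
  have "s d * lam 0 ^ d \<le> B" for d
  proof (cases "d < d0")
    case True
    then have "\<bar>s d * lam 0 ^ d\<bar> \<le> (\<Sum>d<d0. \<bar>s d * lam 0 ^ d\<bar>)"
      by (intro member_le_sum[of d "{..<d0}" "\<lambda>d. \<bar>s d * lam 0 ^ d\<bar>"]) auto
    then show ?thesis using \<open>r > 0\<close> by (simp add: B_def)
  next
    case False
    then have "s d * lam 0 ^ d \<le> r" using large by simp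
    then show ?thesis
      unfolding B_def by (smt (verit) sum_nonneg abs_ge_zero)
  qed
  then show ?thesis by blast
qed

text \<open>Dyadic summation of \<open>s d * (\<Prod>i<d. lam (j i))\<close> over finite boxes, with
  \<open>C * real d powr q\<close> as the constant of the level counts. The factor \<open>Z\<close>
  depends neither on \<open>d\<close> nor on the box, so the box may grow to all tuples.\<close>

lemma ell_norm_growth_of_complexity_bound:
  assumes bound: "complexity_bound N C p q" and "0 < C" "0 < p" "0 \<le> q" and \<tau>: "p / 2 < \<tau>"
  shows "in_ell \<tau> lam \<and> (\<exists>K>0. \<forall>d\<ge>1. (s d * ell_norm \<tau> lam ^ d) powr \<tau> \<le> K * real d powr q)"
proof -
  have \<tau>0: "0 < \<tau>" using assms by simp
  obtain B where B: "\<And>d. d \<ge> 1 \<Longrightarrow> s d * lam 0 ^ d \<le> B"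
    using largest_eigenvalue_bounded[OF bound] assms by blast
  define Z where "Z = B powr \<tau> + 2 powr (p / 2) / (1 - 2 powr (p / 2 - \<tau>))"
  have "2 powr (p / 2 - \<tau>) < (1::real)"
    using \<tau> by (simp add: powr_less_one)
  then have "Z > 0"
    by (auto simp: Z_def intro!: add_nonneg_pos)
  have partial: "s d powr \<tau> * (\<Sum>m<M. lam m powr \<tau>) ^ d \<le> C * Z * real d powr q" if d: "d \<ge> 1" for d M
  proof -
    define F where "F = {..<d} \<rightarrow>\<^sub>E {..<M}"
    have finF: "finite F" by (simp add: F_def finite_PiE)
    have "(\<Sum>j\<in>F. (s d * (\<Prod>i<d. lam (j i))) powr \<tau>) \<le> (C * real d powr q) * Z"
      unfolding Z_def
    proof (rule sum_powr_le_of_level_counts[OF finF])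
      fix j assume "j \<in> F"
      show "0 \<le> s d * (\<Prod>i<d. lam (j i))"
        using s_pos[OF d] nonneg by (simp add: prod_nonneg)
      have "(\<Prod>i<d. lam (j i)) \<le> (\<Prod>i<d. lam 0)"
        using nonneg le_lam0 by (intro prod_mono) auto
      then have "s d * (\<Prod>i<d. lam (j i)) \<le> s d * lam 0 ^ d"
        using s_pos[OF d] by simp
      then show "s d * (\<Prod>i<d. lam (j i)) \<le> B"
        using B[OF d] by linarith
    next
      fix \<epsilon> :: real assume \<epsilon>: "0 < \<epsilon>" "\<epsilon> \<le> 1"
      have "{j \<in> F. \<epsilon>\<^sup>2 < s d * (\<Prod>i<d. lam (j i))} \<subseteq> {j \<in> {..<d} \<rightarrow>\<^sub>E UNIV. \<epsilon>\<^sup>2 / s d < (\<Prod>i<d. lam (j i))}"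
        using s_pos[OF d] by (auto simp: F_def PiE_iff field_simps)
      then have "card {j \<in> F. \<epsilon>\<^sup>2 < s d * (\<Prod>i<d. lam (j i))} \<le> N \<epsilon> d"
        unfolding N[OF \<epsilon> d] using s_pos[OF d] \<epsilon> by (intro card_mono finite_level) auto
      then have "real (card {j \<in> F. \<epsilon>\<^sup>2 < s d * (\<Prod>i<d. lam (j i))}) \<le> real (N \<epsilon> d)"
        by simp
      also have "\<dots> \<le> C * \<epsilon> powr (-p) * real d powr q"
        using bound \<epsilon> d unfolding complexity_bound_def by auto
      finally show "real (card {j \<in> F. \<epsilon>\<^sup>2 < s d * (\<Prod>i<d. lam (j i))}) \<le> C * real d powr q * \<epsilon> powr (-p)"
        by (simp add: mult_ac)
    qed (use assms in auto)
    also have "(\<Sum>j\<in>F. (s d * (\<Prod>i<d. lam (j i))) powr \<tau>) = s d powr \<tau> * (\<Sum>j\<in>F. \<Prod>i<d. lam (j i) powr \<tau>)"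
      using s_pos[OF d] nonneg
      by (simp add: powr_mult prod_nonneg prod_powr_distrib sum_distrib_left)
    also have "(\<Sum>j\<in>F. \<Prod>i<d. lam (j i) powr \<tau>) = (\<Prod>i<d. \<Sum>m<M. lam m powr \<tau>)"
      unfolding F_def by (subst prod_sum_PiE) auto
    finally show ?thesis by (simp add: mult_ac)
  qed
  \<comment> \<open>The case \<open>d = 1\<close> bounds the partial sums of the series
    itself.\<close>
  have ell: "in_ell \<tau> lam"
    unfolding in_ell_def
  proof (rule summableI_nonneg_bounded)
    show "(\<Sum>m<M. lam m powr \<tau>) \<le> C * Z / s 1 powr \<tau>" for M
      using partial[of 1 M] s_pos[of 1] by (simp add: field_simps)
  qed simp
  have ellpos: "0 < ell_norm \<tau> lam"
    using lam0_less_ell_norm[OF \<tau>0 ell] lam0 by simp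
  have "(s d * ell_norm \<tau> lam ^ d) powr \<tau> \<le> C * Z * real d powr q" if d: "d \<ge> 1" for d
  proof -
    have "(\<lambda>M. s d powr \<tau> * (\<Sum>m<M. lam m powr \<tau>) ^ d) \<longlonglongrightarrow> s d powr \<tau> * (\<Sum>m. lam m powr \<tau>) ^ d"
      using ell by (intro tendsto_intros summable_LIMSEQ) (simp add: in_ell_def)
    then have "s d powr \<tau> * (\<Sum>m. lam m powr \<tau>) ^ d \<le> C * Z * real d powr q"
      using partial[OF d] by (intro LIMSEQ_le_const2) auto
    moreover have "(s d * ell_norm \<tau> lam ^ d) powr \<tau> = s d powr \<tau> * (\<Sum>m. lam m powr \<tau>) ^ d"
      unfolding ell_powr[OF \<tau>0 ell, symmetric] using ellpos s_pos[OF d]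
      by (simp add: powr_mult powr_power powr_powr mult.commute flip: powr_realpow)
    ultimately show ?thesis by simp
  qed
  then show ?thesis
    using ell \<open>Z > 0\<close> \<open>0 < C\<close> by (intro conjI exI[of _ "C * Z"]) auto
qed

text \<open>Under \<open>d\<close>-th roots the polynomial factor tends to 1, leaving the upper
  bound \<open>1 / ell_norm \<tau> lam\<close>, which is strictly below
  \<open>1 / lam 0\<close>.\<close>

lemma limsup_root_of_ell_norm_growth:
  assumes \<tau>: "0 < \<tau>" and ell: "in_ell \<tau> lam" and "0 < K"
    and growth: "\<And>d. d \<ge> 1 \<Longrightarrow> (s d * ell_norm \<tau> lam ^ d) powr \<tau> \<le> K * real d powr q"
  shows "limsup (\<lambda>d. ereal (root d (s d))) < ereal (1 / lam 0)"
proof -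
  let ?l = "ell_norm \<tau> lam"
  have l: "lam 0 < ?l" "0 < ?l"
    using lam0_less_ell_norm[OF \<tau> ell] lam0 by auto
  \<comment> \<open>The \<open>d\<close>-th root of
    \<open>(K * real d powr q) powr (1 / \<tau>)\<close> divided by the norm, in exponential form so
    that the limit follows from that of \<open>ln d / d\<close>.\<close>
  define u where "u d = exp ((ln K / real d + q * (ln (real d) / real d)) / \<tau>) / ?l" for d
  have le_u: "root d (s d) \<le> u d" if d: "d \<ge> 1" for d
  proof -
    have pos: "0 < s d * ?l ^ d" using s_pos[OF d] l by simp
    have "s d * ?l ^ d = ((s d * ?l ^ d) powr \<tau>) powr (1 / \<tau>)"
      using pos \<tau> by (simp add: powr_powr)
    also have "\<dots> \<le> (K * real d powr q) powr (1 / \<tau>)"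
      using growth[OF d] \<tau> by (intro powr_mono2) auto
    finally have "root d (s d * ?l ^ d) \<le> root d ((K * real d powr q) powr (1 / \<tau>))"
      using d by (intro real_root_le_mono) auto
    also have "\<dots> = exp ((ln K / real d + q * (ln (real d) / real d)) / \<tau>)"
      using d \<open>0 < K\<close> \<tau>
      by (simp add: root_powr_inverse powr_def ln_mult field_simps)
    finally show ?thesis
      using d l by (simp add: u_def real_root_mult real_root_power_cancel field_simps)
  qed
  have "u \<longlonglongrightarrow> exp ((0 + q * 0) / \<tau>) / ?l"
    unfolding u_def
    using l \<tau> by (intro tendsto_intros lim_const_over_n lim_ln_over_n) auto
  then have "(\<lambda>d. ereal (u d)) \<longlonglongrightarrow> ereal (1 / ?l)"
    by simp
  then have "limsup (\<lambda>d. ereal (u d)) = ereal (1 / ?l)"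
    by (intro lim_imp_Limsup) auto
  moreover have "limsup (\<lambda>d. ereal (root d (s d))) \<le> limsup (\<lambda>d. ereal (u d))"
    using le_u by (intro Limsup_mono eventually_sequentiallyI[of 1]) auto
  moreover have "1 / ?l < 1 / lam 0"
    using l lam0 by (simp add: field_simps)
  ultimately show ?thesis
    by (metis ereal_less(2) le_less_trans less_ereal.simps(1))
qed

text \<open>As \<open>\<tau> \<rightarrow> \<infinity>\<close>, the \<open>\<tau>\<close>-norm tends to \<open>lam 0\<close>.\<close>
lemma ell_scaling_of_limsup_root:
  assumes \<rho>: "0 < \<rho>" "in_ell \<rho> lam"
    and ls: "limsup (\<lambda>d. ereal (root d (s d))) < ereal (1 / lam 0)"
  shows "\<exists>\<tau>. ell_scaling_condition s lam \<tau>"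
proof -
  obtain c where c: "limsup (\<lambda>d. ereal (root d (s d))) < ereal c" "c < 1 / lam 0"
    using ereal_dense2[OF ls] by auto
  from Limsup_lessD[OF c(1)] obtain d0 where d0: "\<And>d. d \<ge> d0 \<Longrightarrow> root d (s d) < c"
    by (auto simp: eventually_sequentially)
  have "0 < root (Suc d0) (s (Suc d0))"
    using s_pos[of "Suc d0"] by simp
  also have "\<dots> < c" by (rule d0) simp
  finally have "c > 0" .
  \<comment> \<open>Here \<open>b * lam 0 = 1 / c\<close>. Since \<open>b > 1\<close>, a large power
    of \<open>b\<close> absorbs the constant \<open>K\<close>, which gives
    \<open>ell_norm \<tau> lam \<le> 1 / c\<close>.\<close>
  define b where "b = 1 / (lam 0 * c)"
  have "b > 1"
    using c(2) \<open>c > 0\<close> lam0 by (simp add: b_def field_simps)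
  define K where "K = (\<Sum>m. lam m powr \<rho>) / lam 0 powr \<rho>"
  obtain n1 where n1: "K < b ^ n1"
    using real_arch_pow[OF \<open>b > 1\<close>] by blast
  \<comment> \<open>The exponent has to exceed \<open>\<rho>\<close>, for summability, and to be
    large enough for \<open>K \<le> b powr \<tau>\<close>.\<close>
  define n where "n = max n1 (nat \<lceil>\<rho>\<rceil> + 1)"
  define \<tau> where "\<tau> = real n"
  have \<tau>: "\<rho> \<le> \<tau>" "0 < \<tau>"
    using \<rho>(1) by (auto simp: \<tau>_def n_def) linarith
  have "K \<le> b powr \<tau>"
  proof -
    have "b ^ n1 \<le> b ^ n"
      using \<open>b > 1\<close> by (intro power_increasing) (auto simp: n_def)
    with n1 have "K \<le> b ^ n" by linarith
    then show ?thesis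
      using \<open>b > 1\<close> by (simp add: \<tau>_def powr_realpow)
  qed
  have le: "lam m powr \<tau> \<le> lam 0 powr (\<tau> - \<rho>) * lam m powr \<rho>" for m
  proof (cases "lam m = 0")
    case False
    then have "lam m powr \<tau> = lam m powr (\<tau> - \<rho>) * lam m powr \<rho>"
      by (simp flip: powr_add)
    also have "\<dots> \<le> lam 0 powr (\<tau> - \<rho>) * lam m powr \<rho>"
      using nonneg le_lam0 \<tau> by (intro mult_right_mono powr_mono2) auto
    finally show ?thesis .
  qed (use \<tau> in simp)
  have sum\<rho>: "summable (\<lambda>m. lam 0 powr (\<tau> - \<rho>) * lam m powr \<rho>)"
    using \<rho>(2) by (intro summable_mult) (simp add: in_ell_def)
  have ell: "in_ell \<tau> lam"
    unfolding in_ell_def by (rule summable_comparison_test'[OF sum\<rho>]) (use le in simp)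
  have "(\<Sum>m. lam m powr \<tau>) \<le> (\<Sum>m. lam 0 powr (\<tau> - \<rho>) * lam m powr \<rho>)"
    using le ell sum\<rho> by (intro suminf_le) (auto simp: in_ell_def)
  also have "\<dots> = lam 0 powr (\<tau> - \<rho>) * (\<Sum>m. lam m powr \<rho>)"
    using \<rho>(2) by (intro suminf_mult) (simp add: in_ell_def)
  also have "\<dots> = lam 0 powr \<tau> * K"
    by (simp add: K_def powr_diff)
  also have "\<dots> \<le> lam 0 powr \<tau> * b powr \<tau>"
    using \<open>K \<le> b powr \<tau>\<close> by (intro mult_left_mono) auto
  also have "\<dots> = (1 / c) powr \<tau>"
    using lam0 \<open>c > 0\<close> \<open>b > 1\<close> by (simp add: powr_mult[symmetric] b_def)
  finally have "ell_norm \<tau> lam \<le> ((1 / c) powr \<tau>) powr (1 / \<tau>)"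
    unfolding ell_norm_def using \<tau> ell
    by (intro powr_mono2) (auto simp: in_ell_def intro!: suminf_nonneg)
  then have ell_le: "ell_norm \<tau> lam \<le> 1 / c"
    using \<tau> \<open>c > 0\<close> by (simp add: powr_powr)
  have ell0: "0 \<le> ell_norm \<tau> lam"
    by (simp add: ell_norm_def)
  define L where "L = 1 + (\<Sum>d<d0. \<bar>s d * ell_norm \<tau> lam ^ d\<bar>)"
  have "s d * ell_norm \<tau> lam ^ d \<le> L" if d: "d \<ge> 1" for d
  proof (cases "d < d0")
    case True
    then have "\<bar>s d * ell_norm \<tau> lam ^ d\<bar> \<le> (\<Sum>d<d0. \<bar>s d * ell_norm \<tau> lam ^ d\<bar>)"
      by (intro member_le_sum[of d "{..<d0}" "\<lambda>d. \<bar>s d * ell_norm \<tau> lam ^ d\<bar>"]) auto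
    then show ?thesis by (simp add: L_def)
  next
    case False
    have "s d = root d (s d) ^ d"
      using d s_pos[OF d] by simp
    also have "\<dots> \<le> c ^ d"
      using d0[of d] False s_pos[OF d] by (intro power_mono) (auto simp: less_imp_le real_root_ge_zero)
    finally have "s d * ell_norm \<tau> lam ^ d \<le> c ^ d * (1 / c) ^ d"
      using ell_le ell0 \<open>c > 0\<close> by (intro mult_mono power_mono) auto
    also have "\<dots> = 1"
      using \<open>c > 0\<close> by (simp flip: power_mult_distrib)
    finally show ?thesis
      unfolding L_def by (smt (verit) sum_nonneg abs_ge_zero)
  qed
  then show ?thesis
    using \<tau>(2) ell unfolding ell_scaling_condition_iff by blast
qed

text \<open>For \<open>q = 0\<close> the growth bound is independent of \<open>d\<close>. That every
  \<open>\<tau> > p / 2\<close> is reached gives the lower bound on the exponent.\<close>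

lemma ell_scaling_of_complexity_bound:
  assumes "complexity_bound N C p 0" "0 < C" "0 < p" "p / 2 < \<tau>"
  shows "ell_scaling_condition s lam \<tau>"
proof -
  have \<tau>: "0 < \<tau>" using assms by simp
  obtain K where ell: "in_ell \<tau> lam" and "K > 0"
    and K: "\<And>d. d \<ge> 1 \<Longrightarrow> (s d * ell_norm \<tau> lam ^ d) powr \<tau> \<le> K * real d powr 0"
    using ell_norm_growth_of_complexity_bound[OF assms(1-3) order_refl assms(4)] by blast
  have "s d * ell_norm \<tau> lam ^ d \<le> K powr (1 / \<tau>)" if d: "d \<ge> 1" for d
  proof -
    have "0 \<le> s d * ell_norm \<tau> lam ^ d"
      using s_pos[OF d] by (simp add: ell_norm_def)
    then have "s d * ell_norm \<tau> lam ^ d = ((s d * ell_norm \<tau> lam ^ d) powr \<tau>) powr (1 / \<tau>)"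
      using \<tau> by (simp add: powr_powr)
    also have "\<dots> \<le> K powr (1 / \<tau>)"
      using K[OF d] \<tau> d by (intro powr_mono2) auto
    finally show ?thesis .
  qed
  then show ?thesis
    using \<tau> ell unfolding ell_scaling_condition_iff by blast
qed

text \<open>The implications run in the cycle (I), (II), (IV), (III), (I); the exponent formula
  compares the two infima.\<close>

theorem tractability_characterisation:
  "(strongly_polynomially_tractable N \<longleftrightarrow> polynomially_tractable N) \<and>
   (polynomially_tractable N \<longleftrightarrow> (\<exists>\<tau>. ell_scaling_condition s lam \<tau>)) \<and>
   ((\<exists>\<tau>. ell_scaling_condition s lam \<tau>) \<longleftrightarrow>
      (\<exists>\<rho>>0. in_ell \<rho> lam \<and> limsup (\<lambda>d. ereal (root d (s d))) < ereal (1 / lam 0))) \<and>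
   (strongly_polynomially_tractable N \<longrightarrow>
      strong_tractability_exponent N = Inf {2 * \<tau> |\<tau>. ell_scaling_condition s lam \<tau>})"
proof -
  let ?II = "polynomially_tractable N" and ?I = "strongly_polynomially_tractable N"
  let ?III = "\<exists>\<tau>. ell_scaling_condition s lam \<tau>"
  let ?IV = "\<exists>\<rho>>0. in_ell \<rho> lam \<and> limsup (\<lambda>d. ereal (root d (s d))) < ereal (1 / lam 0)"
  have 1: ?II if ?I
    using that unfolding strongly_polynomially_tractable_def polynomially_tractable_def by blast
  have 2: ?IV if ?II
  proof -
    obtain C p q where "0 < C" and p: "0 < p" "0 \<le> q" "complexity_bound N C p q"
      using \<open>?II\<close> unfolding polynomially_tractable_def by blast
    define \<tau> where "\<tau> = p / 2 + 1"
    have \<tau>: "0 < \<tau>" "p / 2 < \<tau>" using p by (auto simp: \<tau>_def)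
    obtain K where "in_ell \<tau> lam" "K > 0"
      "\<And>d. d \<ge> 1 \<Longrightarrow> (s d * ell_norm \<tau> lam ^ d) powr \<tau> \<le> K * real d powr q"
      using ell_norm_growth_of_complexity_bound[OF p(3) \<open>0 < C\<close> p(1,2) \<tau>(2)] by blast
    then show ?thesis
      using limsup_root_of_ell_norm_growth[OF \<tau>(1)] \<tau>(1) by blast
  qed
  have 3: ?III if ?IV
    using that ell_scaling_of_limsup_root by blast
  have 4: ?I if ?III
  proof -
    obtain \<tau> where \<tau>: "ell_scaling_condition s lam \<tau>" using \<open>?III\<close> by blast
    then have "0 < 2 * \<tau>" by (simp add: ell_scaling_condition_def)
    then show ?thesis
      using complexity_bound_of_ell_scaling[OF \<tau>]
      unfolding strongly_polynomially_tractable_def by blast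
  qed
  have 5: "strong_tractability_exponent N = Inf {2 * \<tau> |\<tau>. ell_scaling_condition s lam \<tau>}" if ?I
  proof -
    define A where "A = {p. 0 < p \<and> (\<exists>C>0. complexity_bound N C p 0)}"
    define E where "E = {2 * \<tau> |\<tau>. ell_scaling_condition s lam \<tau>}"
    \<comment> \<open>Comparing real infima requires nonempty sets bounded below; tractability makes
      both \<open>A\<close> and \<open>E\<close> nonempty.\<close>
    have "A \<noteq> {}"
      using that unfolding strongly_polynomially_tractable_def A_def by blast
    have "E \<noteq> {}"
      using 3[OF 2[OF 1[OF that]]] by (auto simp: E_def)
    have EA: "E \<subseteq> A"
      using complexity_bound_of_ell_scaling by (auto simp: E_def A_def ell_scaling_condition_def)
    have bddA: "bdd_below A"
      by (rule bdd_belowI[of _ 0]) (auto simp: A_def)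
    have bddE: "bdd_below E"
      using bddA EA by (rule bdd_below_mono)
    \<comment> \<open>(III) is obtained only for \<open>\<tau>\<close> strictly above
      \<open>p / 2\<close>, so \<open>p\<close> is approached from above.\<close>
    have "Inf E \<le> p" if "p \<in> A" for p
    proof (rule dense_ge)
      fix x assume "p < x"
      obtain C where "0 < C" "0 < p" "complexity_bound N C p 0"
        using \<open>p \<in> A\<close> by (auto simp: A_def)
      then have "ell_scaling_condition s lam (x / 2)"
        using \<open>p < x\<close> by (intro ell_scaling_of_complexity_bound) auto
      then have "2 * (x / 2) \<in> E"
        unfolding E_def by blast
      then show "Inf E \<le> x"
        using bddE by (simp add: cInf_lower)
    qed
    then have "Inf E \<le> Inf A"
      using \<open>A \<noteq> {}\<close> by (intro cInf_greatest)
    moreover have "Inf A \<le> Inf E"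
      using \<open>E \<noteq> {}\<close> bddA EA by (rule cInf_superset_mono)
    ultimately show ?thesis
      by (simp add: strong_tractability_exponent_def A_def E_def)
  qed
  show ?thesis
    using 1 2 3 4 5 by blast
qed

end

section \<open>Application to the scaled tensor product problem\<close>

theorem theorem1:
  fixes S :: "'a::{real_inner, complete_space} \<Rightarrow> 'b::{real_inner, complete_space}"
    and lam :: "nat \<Rightarrow> real"
    and s :: "nat \<Rightarrow> real"
    and TH :: "nat \<Rightarrow> (nat \<Rightarrow> 'a) \<Rightarrow> 'h::{real_inner, complete_space}"
    and H :: "nat \<Rightarrow> 'h set"
    and TG :: "nat \<Rightarrow> (nat \<Rightarrow> 'b) \<Rightarrow> 'g::{real_inner, complete_space}"
    and G :: "nat \<Rightarrow> 'g set"
    and Sd :: "nat \<Rightarrow> 'h \<Rightarrow> 'g"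
  assumes S_compact: "compact_operator S"
    and lam: "eigenvalue_sequence (adjoint S \<circ> S) lam"
    and lam2: "lam 1 > 0"
    and s_pos: "\<And>d. d \<ge> 1 \<Longrightarrow> s d > 0"
    and H: "\<And>d. d \<ge> 1 \<Longrightarrow> hilbert_tensor_power d (TH d) (H d)"
    and G: "\<And>d. d \<ge> 1 \<Longrightarrow> hilbert_tensor_power d (TG d) (G d)"
    and Sd: "\<And>d. d \<ge> 1 \<Longrightarrow> tensor_power_operator S (TH d) (H d) (TG d) (G d) (Sd d)"
  shows "(strongly_polynomially_tractable (scaled_complexity s H G Sd) \<longleftrightarrow>
            polynomially_tractable (scaled_complexity s H G Sd)) \<and>
         (polynomially_tractable (scaled_complexity s H G Sd) \<longleftrightarrow>
            (\<exists>\<tau>. ell_scaling_condition s lam \<tau>)) \<and>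
         ((\<exists>\<tau>. ell_scaling_condition s lam \<tau>) \<longleftrightarrow>
            (\<exists>\<rho>>0. in_ell \<rho> lam \<and> limsup (\<lambda>d. ereal (root d (s d))) < ereal (1 / lam 0))) \<and>
         (strongly_polynomially_tractable (scaled_complexity s H G Sd) \<longrightarrow>
            strong_tractability_exponent (scaled_complexity s H G Sd) =
              Inf {2 * \<tau> |\<tau>. ell_scaling_condition s lam \<tau>})"
proof -
  have dec: "decseq lam" and nonneg: "\<And>m. 0 \<le> lam m"
    using lam by (auto simp: eigenvalue_sequence_def)
  \<comment> \<open>The elimination rule of the singular system is applied with this goal as its
    thesis; the vectors \<open>v\<close> are discarded.\<close>
  have lim0: "lam \<longlonglongrightarrow> 0"
    by (rule compact_operator_singular_system[OF S_compact lam])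
  interpret scaled_spectrum lam s "scaled_complexity s H G Sd"
  proof
    show "finite {j \<in> {..<d} \<rightarrow>\<^sub>E UNIV. t < (\<Prod>i<d. lam (j i))}" if "0 < t" for t and d :: nat
      by (rule finite_product_level_set[OF dec nonneg lim0 that])
    show "scaled_complexity s H G Sd \<epsilon> d =
        card {j \<in> {..<d} \<rightarrow>\<^sub>E UNIV. \<epsilon>\<^sup>2 / s d < (\<Prod>i<d. lam (j i))}"
      if "0 < \<epsilon>" "\<epsilon> \<le> 1" "d \<ge> 1" for \<epsilon> d
      unfolding scaled_complexity_def using that
      by (intro information_complexity_tensor_power[OF S_compact lam H G Sd s_pos])
  qed (use dec nonneg lam2 s_pos in auto)
  show ?thesis
    by (rule tractability_characterisation)
qed

end
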